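(* Let $G$ be a $\delta$-negatively curved group (with respect to a fixed finite generating set) and let $\mu \ge 0$. There exists a constant $C_1$, depending only on $G$, $\delta$ and $\mu$, with the following property. Let $H$ and $K$ be any $\mu$-quasiconvex subgroups of $G$ such that $H$ is malnormal in $G$, and put $G_0 = H \cap K$. Let $H_1 \le H$ be any subgroup with $H_1 \cap K = H \cap K = G_0$. If all the elements of $H_1$ which are shorter than $C_1$ belong to $G_0$, then $\langle H_1, K\rangle = H_1 *_{G_0} K$. If, in addition, $H_1$ is quasiconvex in $G$, then the subgroup $\langle H_1, K\rangle$ is quasiconvex in $G$.
   Context: $G$ is a group with a fixed finite generating set $X$, and $X^* = \{x, x^{-1} : x \in X\}$. $\mathrm{Cayley}(G)$ is the Cayley graph of $G$ with respect to $X^*$: its vertex set is $G$, its edge set is $G \times X^*$, and the edge $(g,x)$ joins $g$ to $gx$. The length of an element of $G$ is its word length with respect to $X^*$, and "shorter than $C_1$" means having length strictly less than $C_1$. A geodesic is a shortest path joining two vertices of $\mathrm{Cayley}(G)$. The group $G$ is $\delta$-negatively curved ($\delta \ge 0$) if any side of any geodesic triangle in $\mathrm{Cayley}(G)$ belongs to the $\delta$-neighborhood of the union of the two other sides. A subgroup $H$ of $G$ is $\mu$-quasiconvex in $G$ if any geodesic in $\mathrm{Cayley}(G)$ with both endpoints in $H$ belongs to the $\mu$-neighborhood of $H$; it is quasiconvex in $G$ if it is $\mu'$-quasiconvex for some $\mu' \ge 0$. A subgroup $H$ is malnormal in $G$ if for any $g \in G$ with $g \notin H$ the intersection of $H$ and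 $gHg^{-1}$ is trivial. $\langle H_1, K\rangle$ denotes the smallest subgroup of $G$ containing $H_1$ and $K$. The equality $\langle H_1, K\rangle = H_1 *_{G_0} K$ means that the natural homomorphism from the free product of $H_1$ and $K$ amalgamated along $G_0$ to $\langle H_1, K\rangle$, induced by the inclusions of $H_1$ and $K$ in $G$, is an isomorphism. *)

theory Defs
  imports Complex_Main "HOL-Algebra.Coset" "HOL-Algebra.Generated_Groups" "Graph_Theory.Digraph" "Graph_Theory.Arc_Walk"
begin

section \<open>Cayley graphs and word length\<close>

definition sym_gens :: "('a, 'm) monoid_scheme \<Rightarrow> 'a set \<Rightarrow> 'a set" where
  "sym_gens G S = S \<union> (\<lambda>x. inv\<^bsub>G\<^esub> x) ` S"

text \<open>
  Every edge \<open>(g, x)\<close> has the opposite edge \<open>(g x, x\<inverse>)\<close>, so the directed walks of this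
  digraph are the edge paths of the undirected Cayley graph.
\<close>

definition cayley :: "('a, 'm) monoid_scheme \<Rightarrow> 'a set \<Rightarrow> ('a, 'a \<times> 'a) pre_digraph" where
  "cayley G S = \<lparr> verts = carrier G, arcs = carrier G \<times> sym_gens G S,
     tail = fst, head = (\<lambda>(g, x). g \<otimes>\<^bsub>G\<^esub> x) \<rparr>"

definition word_length :: "('a, 'm) monoid_scheme \<Rightarrow> 'a set \<Rightarrow> 'a \<Rightarrow> nat" where
  "word_length G S g = (LEAST n. \<exists>w. set w \<subseteq> sym_gens G S \<and> length w = n
     \<and> foldr (\<otimes>\<^bsub>G\<^esub>) w \<one>\<^bsub>G\<^esub> = g)"

definition cayley_dist :: "('a, 'm) monoid_scheme \<Rightarrow> 'a set \<Rightarrow> 'a \<Rightarrow> 'a \<Rightarrow> nat" where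
  "cayley_dist G S u v =
     (LEAST n. \<exists>p. pre_digraph.awalk (cayley G S) u p v \<and> length p = n)"

definition geodesic ::
  "('a, 'm) monoid_scheme \<Rightarrow> 'a set \<Rightarrow> 'a \<Rightarrow> ('a \<times> 'a) list \<Rightarrow> 'a \<Rightarrow> bool" where
  "geodesic G S u p v \<longleftrightarrow> pre_digraph.awalk (cayley G S) u p v
     \<and> (\<forall>q. pre_digraph.awalk (cayley G S) u q v \<longrightarrow> length p \<le> length q)"

text \<open>
  Subsets of the Cayley graph are sets of vertices; a path starting at \<open>u\<close> stands for the set
  of the vertices on it.  In the geometric realization, the point of a union of
  edges nearest to a given vertex is again a vertex, so the two conditions below, restricted to
  vertices, follow from the same conditions (with the same constants) on all points of the
  edges; conversely they imply the latter after adding 1 to the constants.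
\<close>

definition path_verts ::
  "('a, 'm) monoid_scheme \<Rightarrow> 'a set \<Rightarrow> 'a \<Rightarrow> ('a \<times> 'a) list \<Rightarrow> 'a set" where
  "path_verts G S u p = set (pre_digraph.awalk_verts (cayley G S) u p)"

definition nbhd :: "('a, 'm) monoid_scheme \<Rightarrow> 'a set \<Rightarrow> real \<Rightarrow> 'a set \<Rightarrow> 'a set" where
  "nbhd G S r Y = {v \<in> carrier G. \<exists>s \<in> Y. real (cayley_dist G S v s) \<le> r}"

definition negatively_curved :: "('a, 'm) monoid_scheme \<Rightarrow> 'a set \<Rightarrow> real \<Rightarrow> bool" where
  "negatively_curved G S \<delta> \<longleftrightarrow>
     (\<forall>a b c p q r. geodesic G S a p b \<and> geodesic G S b q c \<and> geodesic G S c r a \<longrightarrow>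
        path_verts G S a p \<subseteq> nbhd G S \<delta> (path_verts G S b q \<union> path_verts G S c r) \<and>
        path_verts G S b q \<subseteq> nbhd G S \<delta> (path_verts G S c r \<union> path_verts G S a p) \<and>
        path_verts G S c r \<subseteq> nbhd G S \<delta> (path_verts G S a p \<union> path_verts G S b q))"

definition quasiconvex_with ::
  "('a, 'm) monoid_scheme \<Rightarrow> 'a set \<Rightarrow> real \<Rightarrow> 'a set \<Rightarrow> bool" where
  "quasiconvex_with G S \<mu> H \<longleftrightarrow>
     (\<forall>a \<in> H. \<forall>b \<in> H. \<forall>p. geodesic G S a p b \<longrightarrow> path_verts G S a p \<subseteq> nbhd G S \<mu> H)"

definition quasiconvex :: "('a, 'm) monoid_scheme \<Rightarrow> 'a set \<Rightarrow> 'a set \<Rightarrow> bool" where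
  "quasiconvex G S H \<longleftrightarrow> (\<exists>\<mu> \<ge> 0. quasiconvex_with G S \<mu> H)"

definition malnormal :: "('a, 'm) monoid_scheme \<Rightarrow> 'a set \<Rightarrow> bool" where
  "malnormal G H \<longleftrightarrow>
     (\<forall>g \<in> carrier G. g \<notin> H \<longrightarrow> H \<inter> (g <#\<^bsub>G\<^esub> H #>\<^bsub>G\<^esub> inv\<^bsub>G\<^esub> g) = {\<one>\<^bsub>G\<^esub>})"


section \<open>Amalgamated free products\<close>

text \<open>
  The free product of \<open>A\<close> and \<open>B\<close> amalgamated along \<open>i : C \<rightarrow> A\<close> and \<open>j : C \<rightarrow> B\<close>: words in the
  disjoint union of \<open>A\<close> and \<open>B\<close> modulo the congruence generated by the multiplication
  tables of \<open>A\<close> and \<open>B\<close> and by \<open>i c = j c\<close>.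
\<close>

definition amalg_words :: "('a, 'm) monoid_scheme \<Rightarrow> ('b, 'n) monoid_scheme \<Rightarrow> ('a + 'b) list set"
  where "amalg_words A B = lists (carrier A <+> carrier B)"

inductive amalg_eq ::
  "('a, 'm) monoid_scheme \<Rightarrow> ('b, 'n) monoid_scheme \<Rightarrow> 'c set \<Rightarrow> ('c \<Rightarrow> 'a) \<Rightarrow> ('c \<Rightarrow> 'b) \<Rightarrow>
     ('a + 'b) list \<Rightarrow> ('a + 'b) list \<Rightarrow> bool"
  for A :: "('a, 'm) monoid_scheme" and B :: "('b, 'n) monoid_scheme"
    and C :: "'c set" and i :: "'c \<Rightarrow> 'a" and j :: "'c \<Rightarrow> 'b"
  where
  refl: "w \<in> amalg_words A B \<Longrightarrow> amalg_eq A B C i j w w"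
| sym: "amalg_eq A B C i j u v \<Longrightarrow> amalg_eq A B C i j v u"
| trans: "amalg_eq A B C i j u v \<Longrightarrow> amalg_eq A B C i j v w \<Longrightarrow> amalg_eq A B C i j u w"
| append: "amalg_eq A B C i j u u' \<Longrightarrow> amalg_eq A B C i j v v' \<Longrightarrow>
    amalg_eq A B C i j (u @ v) (u' @ v')"
| one_left: "amalg_eq A B C i j [Inl \<one>\<^bsub>A\<^esub>] []"
| one_right: "amalg_eq A B C i j [Inr \<one>\<^bsub>B\<^esub>] []"
| mult_left: "a \<in> carrier A \<Longrightarrow> a' \<in> carrier A \<Longrightarrow>
    amalg_eq A B C i j [Inl a, Inl a'] [Inl (a \<otimes>\<^bsub>A\<^esub> a')]"
| mult_right: "b \<in> carrier B \<Longrightarrow> b' \<in> carrier B \<Longrightarrow>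
    amalg_eq A B C i j [Inr b, Inr b'] [Inr (b \<otimes>\<^bsub>B\<^esub> b')]"
| amalg: "c \<in> C \<Longrightarrow> amalg_eq A B C i j [Inl (i c)] [Inr (j c)]"

definition amalg_rel ::
  "('a, 'm) monoid_scheme \<Rightarrow> ('b, 'n) monoid_scheme \<Rightarrow> 'c set \<Rightarrow> ('c \<Rightarrow> 'a) \<Rightarrow> ('c \<Rightarrow> 'b) \<Rightarrow>
     (('a + 'b) list \<times> ('a + 'b) list) set" where
  "amalg_rel A B C i j = {(u, v). amalg_eq A B C i j u v}"

definition amalgam ::
  "('a, 'm) monoid_scheme \<Rightarrow> ('b, 'n) monoid_scheme \<Rightarrow> 'c set \<Rightarrow> ('c \<Rightarrow> 'a) \<Rightarrow> ('c \<Rightarrow> 'b) \<Rightarrow>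
     ('a + 'b) list set monoid" where
  "amalgam A B C i j =
     \<lparr> carrier = amalg_words A B // amalg_rel A B C i j,
       mult = (\<lambda>U V. \<Union>u \<in> U. \<Union>v \<in> V. amalg_rel A B C i j `` {u @ v}),
       one = amalg_rel A B C i j `` {[]} \<rparr>"

definition word_value ::
  "('d, 'k) monoid_scheme \<Rightarrow> ('a \<Rightarrow> 'd) \<Rightarrow> ('b \<Rightarrow> 'd) \<Rightarrow> ('a + 'b) list \<Rightarrow> 'd" where
  "word_value L f g w = foldr (\<lambda>s y. case_sum f g s \<otimes>\<^bsub>L\<^esub> y) w \<one>\<^bsub>L\<^esub>"

text \<open>The map on the amalgam induced by \<open>f : A \<rightarrow> L\<close> and \<open>g : B \<rightarrow> L\<close> agreeing on \<open>C\<close>.\<close>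

definition amalgam_map ::
  "('d, 'k) monoid_scheme \<Rightarrow> ('a \<Rightarrow> 'd) \<Rightarrow> ('b \<Rightarrow> 'd) \<Rightarrow> ('a + 'b) list set \<Rightarrow> 'd" where
  "amalgam_map L f g W = the_elem (word_value L f g ` W)"

definition is_amalgam_of ::
  "('a, 'm) monoid_scheme \<Rightarrow> 'a set \<Rightarrow> 'a set \<Rightarrow> 'a set \<Rightarrow> bool" where
  "is_amalgam_of G H K C \<longleftrightarrow>
     amalgam_map G (\<lambda>x. x) (\<lambda>x. x) \<in>
       iso (amalgam (G\<lparr>carrier := H\<rparr>) (G\<lparr>carrier := K\<rparr>) C (\<lambda>x. x) (\<lambda>x. x))
           (G\<lparr>carrier := generate G (H \<union> K)\<rparr>)"


subsection \<open>The amalgam is a group with the expected universal property\<close>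

locale amalgam_setup =
  A: group A + B: group B
  for A :: "('a, 'm) monoid_scheme" (structure) and B :: "('b, 'n) monoid_scheme" (structure) +
  fixes C :: "'c set" and i :: "'c \<Rightarrow> 'a" and j :: "'c \<Rightarrow> 'b"
  assumes i_closed: "c \<in> C \<Longrightarrow> i c \<in> carrier A"
    and j_closed: "c \<in> C \<Longrightarrow> j c \<in> carrier B"
begin

abbreviation "W \<equiv> amalg_words A B"
abbreviation "R \<equiv> amalg_rel A B C i j"
abbreviation "P \<equiv> amalgam A B C i j"

lemma amalg_eq_words: "amalg_eq A B C i j u v \<Longrightarrow> u \<in> W \<and> v \<in> W"
  by (induction rule: amalg_eq.induct) (auto simp: amalg_words_def i_closed j_closed)

lemma equiv_R: "equiv W R"
proof (rule equivI)
  show "R \<subseteq> W \<times> W" by (auto simp: amalg_rel_def dest: amalg_eq_words)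
  show "refl_on W R" by (auto simp: amalg_rel_def refl_on_def intro: amalg_eq.refl)
  show "sym R" by (auto simp: amalg_rel_def intro!: symI elim: amalg_eq.sym)
  show "trans R" by (auto simp: amalg_rel_def intro!: transI elim: amalg_eq.trans)
qed

lemma mult_class:
  assumes "u \<in> W" "v \<in> W"
  shows "R `` {u} \<otimes>\<^bsub>P\<^esub> R `` {v} = R `` {u @ v}"
proof -
  have eq: "R `` {u' @ v'} = R `` {u @ v}" if "u' \<in> R `` {u}" "v' \<in> R `` {v}" for u' v'
  proof -
    have "amalg_eq A B C i j (u @ v) (u' @ v')"
      using that by (intro amalg_eq.append) (simp_all add: amalg_rel_def)
    then show ?thesis
      by (intro equiv_class_eq[OF equiv_R, symmetric]) (simp add: amalg_rel_def)
  qed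
  have uv: "u \<in> R `` {u}" "v \<in> R `` {v}"
    using assms by (simp_all add: amalg_rel_def amalg_eq.refl)
  have "R `` {u} \<otimes>\<^bsub>P\<^esub> R `` {v}
      = (\<Union>u' \<in> R `` {u}. \<Union>v' \<in> R `` {v}. R `` {u' @ v'})"
    by (simp add: amalgam_def)
  also have "\<dots> = (\<Union>u' \<in> R `` {u}. \<Union>v' \<in> R `` {v}. R `` {u @ v})"
    by (intro SUP_cong HOL.refl eq)
  also have "\<dots> = R `` {u @ v}"
    using uv by blast
  finally show ?thesis .
qed

lemma carrier_P: "carrier P = (\<lambda>w. R `` {w}) ` W"
  by (auto simp: amalgam_def quotient_def)

lemma one_P: "\<one>\<^bsub>P\<^esub> = R `` {[]}"
  by (simp add: amalgam_def)

lemma words_append: "u \<in> W \<Longrightarrow> v \<in> W \<Longrightarrow> u @ v \<in> W" and words_Nil: "[] \<in> W"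
  by (auto simp: amalg_words_def)

lemma inverse_word:
  assumes "w \<in> W"
  shows "\<exists>w' \<in> W. amalg_eq A B C i j (w' @ w) []"
  using assms
proof (induction w)
  case Nil
  then show ?case by (auto intro!: bexI[of _ "[]"] amalg_eq.refl)
next
  case (Cons s w)
  then have w: "w \<in> W" and s: "s \<in> carrier A <+> carrier B" by (auto simp: amalg_words_def)
  obtain w' where w': "w' \<in> W" "amalg_eq A B C i j (w' @ w) []" using Cons w by auto
  have "\<exists>t. [t] \<in> W \<and> amalg_eq A B C i j [t, s] []"
  proof (cases s)
    case (Inl a)
    with s have "a \<in> carrier A" by auto
    then have "amalg_eq A B C i j [Inl (inv\<^bsub>A\<^esub> a), Inl a] [Inl \<one>\<^bsub>A\<^esub>]"
      using amalg_eq.mult_left[of "inv\<^bsub>A\<^esub> a" A a] by simp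
    then have "amalg_eq A B C i j [Inl (inv\<^bsub>A\<^esub> a), s] []"
      unfolding Inl by (rule amalg_eq.trans) (rule amalg_eq.one_left)
    moreover have "[Inl (inv\<^bsub>A\<^esub> a)] \<in> W"
      using \<open>a \<in> carrier A\<close> by (auto simp: amalg_words_def)
    ultimately show ?thesis by blast
  next
    case (Inr b)
    with s have "b \<in> carrier B" by auto
    then have "amalg_eq A B C i j [Inr (inv\<^bsub>B\<^esub> b), Inr b] [Inr \<one>\<^bsub>B\<^esub>]"
      using amalg_eq.mult_right[of "inv\<^bsub>B\<^esub> b" B b] by simp
    then have "amalg_eq A B C i j [Inr (inv\<^bsub>B\<^esub> b), s] []"
      unfolding Inr by (rule amalg_eq.trans) (rule amalg_eq.one_right)
    moreover have "[Inr (inv\<^bsub>B\<^esub> b)] \<in> W"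
      using \<open>b \<in> carrier B\<close> by (auto simp: amalg_words_def)
    ultimately show ?thesis by blast
  qed
  then obtain t where t: "[t] \<in> W" "amalg_eq A B C i j [t, s] []" by blast
  have "amalg_eq A B C i j (w' @ ([t, s] @ w)) (w' @ ([] @ w))"
    using w w' t by (intro amalg_eq.append amalg_eq.refl)
  then have "amalg_eq A B C i j (w' @ ([t, s] @ w)) []"
    by (rule amalg_eq.trans) (simp add: w'(2))
  then have "amalg_eq A B C i j ((w' @ [t]) @ s # w) []"
    by simp
  then show ?case using words_append[OF w'(1) t(1)] by blast
qed

lemma group_amalgam: "group P"
proof (rule groupI)
  fix x assume "x \<in> carrier P"
  then obtain w where w: "w \<in> W" "x = R `` {w}" by (auto simp: carrier_P)
  obtain w' where w': "w' \<in> W" "amalg_eq A B C i j (w' @ w) []" using inverse_word w by blast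
  have "R `` {w' @ w} = R `` {[]}"
    using w' by (intro equiv_class_eq[OF equiv_R]) (simp add: amalg_rel_def)
  then show "\<exists>y \<in> carrier P. y \<otimes>\<^bsub>P\<^esub> x = \<one>\<^bsub>P\<^esub>"
    using w w' by (auto simp: carrier_P mult_class one_P)
qed (auto simp: carrier_P mult_class one_P words_append words_Nil)

context
  fixes L :: "('d, 'k) monoid_scheme" and f g
  assumes L: "group L" and f: "f \<in> hom A L" and g: "g \<in> hom B L"
    and fg: "\<And>c. c \<in> C \<Longrightarrow> f (i c) = g (j c)"
begin

interpretation L: group L by (fact L)

lemma letter_closed: "s \<in> carrier A <+> carrier B \<Longrightarrow> case_sum f g s \<in> carrier L"
  using f g by (auto simp: hom_def)

lemma word_value_closed: "w \<in> W \<Longrightarrow> word_value L f g w \<in> carrier L"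
  by (induction w) (auto simp: amalg_words_def word_value_def dest!: letter_closed)

lemma word_value_append:
  "u \<in> W \<Longrightarrow> v \<in> W \<Longrightarrow>
     word_value L f g (u @ v) = word_value L f g u \<otimes>\<^bsub>L\<^esub> word_value L f g v"
proof (induction u)
  case Nil
  then show ?case using word_value_closed by (simp add: word_value_def)
next
  case (Cons s u)
  then have "u \<in> W" "s \<in> carrier A <+> carrier B" by (auto simp: amalg_words_def)
  then show ?case using Cons letter_closed[of s] word_value_closed
    by (simp add: word_value_def L.m_assoc)
qed

lemma word_value_cong:
  "amalg_eq A B C i j u v \<Longrightarrow> word_value L f g u = word_value L f g v"
proof (induction rule: amalg_eq.induct)
  case (append u u' v v')
  then show ?case using amalg_eq_words[of u u'] amalg_eq_words[of v v']
    by (simp add: word_value_append)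
next
  case one_left
  then show ?case using hom_one[OF f A.is_group L] by (simp add: word_value_def)
next
  case one_right
  then show ?case using hom_one[OF g B.is_group L] by (simp add: word_value_def)
next
  case (mult_left a a')
  then show ?case using f by (simp add: word_value_def hom_def Pi_iff L.m_assoc)
next
  case (mult_right b b')
  then show ?case using g by (simp add: word_value_def hom_def Pi_iff L.m_assoc)
next
  case (amalg c)
  then show ?case using fg by (simp add: word_value_def)
qed auto

lemma amalgam_map_class: "w \<in> W \<Longrightarrow> amalgam_map L f g (R `` {w}) = word_value L f g w"
proof -
  assume w: "w \<in> W"
  have "word_value L f g ` (R `` {w}) = {word_value L f g w}"
    using w by (fastforce simp: amalg_rel_def intro: amalg_eq.refl dest: word_value_cong)
  then show ?thesis by (simp add: amalgam_map_def)
qed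

lemma amalgam_map_hom: "amalgam_map L f g \<in> hom P L"
  by (rule homI)
     (auto simp: carrier_P amalgam_map_class mult_class word_value_closed word_value_append
        words_append)

lemma amalgam_map_left: "a \<in> carrier A \<Longrightarrow> amalgam_map L f g (R `` {[Inl a]}) = f a"
  using f by (subst amalgam_map_class) (auto simp: amalg_words_def word_value_def hom_def Pi_iff)

lemma amalgam_map_right: "b \<in> carrier B \<Longrightarrow> amalgam_map L f g (R `` {[Inr b]}) = g b"
  using g by (subst amalgam_map_class) (auto simp: amalg_words_def word_value_def hom_def Pi_iff)

lemma amalgam_map_unique:
  assumes h: "h \<in> hom P L"
    and hf: "\<And>a. a \<in> carrier A \<Longrightarrow> h (R `` {[Inl a]}) = f a"
    and hg: "\<And>b. b \<in> carrier B \<Longrightarrow> h (R `` {[Inr b]}) = g b"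
    and x: "x \<in> carrier P"
  shows "h x = amalgam_map L f g x"
proof -
  have "h (R `` {w}) = word_value L f g w" if "w \<in> W" for w
    using that
  proof (induction w)
    case Nil
    then show ?case using hom_one[OF h group_amalgam L] by (simp add: one_P word_value_def)
  next
    case (Cons s w)
    then have w: "w \<in> W" and s: "s \<in> carrier A <+> carrier B" and s': "[s] \<in> W"
      by (auto simp: amalg_words_def)
    have "h (R `` {s # w}) = h (R `` {[s]}) \<otimes>\<^bsub>L\<^esub> h (R `` {w})"
      using hom_mult[OF h, of "R `` {[s]}" "R `` {w}"] w s' by (simp add: carrier_P mult_class)
    moreover have "h (R `` {[s]}) = case_sum f g s" using s hf hg by auto
    ultimately show ?case using Cons.IH[OF w] by (simp add: word_value_def)
  qed
  then show ?thesis using x by (auto simp: carrier_P amalgam_map_class)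
qed

end

end

end

theory Submission
  imports Defs
begin

text \<open>
  Every element of \<open>\<langle>H\<^sub>1, K\<rangle>\<close> is a product \<open>k\<^sub>0 h\<^sub>1 k\<^sub>1 h\<^sub>2 \<dots> h\<^sub>n k\<^sub>n\<close> in which every syllable but the
  last is shortest in its coset modulo \<open>G\<^sub>0\<close>, and \<open>h\<^sub>i\<close>, \<open>k\<^sub>1, \<dots>, k\<^bsub>n-1\<^esub>\<close> lie outside \<open>G\<^sub>0\<close>.
  The broken geodesic with sides \<open>k\<^bsub>i-1\<^esub> h\<^sub>i\<close> has uniformly bounded Gromov products at its
  vertices: two sides that fellow-travel for long would, by the pigeonhole principle, contain two
  pairs of nearby points with the same difference, which shortens a syllable by an element of
  \<open>G\<^sub>0\<close> if the sides come from \<open>H\<close> and \<open>K\<close>, and contradicts malnormality if they come from \<open>H\<close>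
  and \<open>k H\<close> with \<open>k\<close> short.  Since the \<open>h\<^sub>i\<close> are long, such a broken geodesic makes progress at
  every vertex, so the product is nontrivial, and geodesics between its ends stay close to it.
\<close>

section \<open>The word metric\<close>

text \<open>The hypotheses make only the syllables from \<open>H\<^sub>1\<close> long; a syllable
  from \<open>K\<close> outside \<open>H \<inter> K\<close> may be short. A broken line with one
  side per syllable could thus have short interior sides, which is why each
  \<open>K\<close>-syllable is joined to the long syllable after it. The price is that a corner may
  have a short \<open>K\<close>-syllable k right behind it. Malnormality bounds the overlap of
  \<open>H\<close> and k \<open>H\<close>, but uniformly only for bounded |k|; hence the case
  distinction on |k|.

  The constant must not depend on \<open>H\<^sub>1\<close>, so every overlap estimate treats
  elements of \<open>H\<^sub>1\<close> as elements of the \<mu>-quasiconvex group \<open>H\<close>.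
  The equality of \<open>H\<^sub>1 \<inter> K\<close> and \<open>H \<inter> K\<close> reconciles the
  two views: the shortest representatives modulo \<open>H \<inter> K\<close> stay in
  \<open>H\<^sub>1\<close>, and the elements of \<open>H \<inter> K\<close> that could shorten a
  syllable are exactly those against which it is minimal.

  Injectivity comes from the geometry: a word of value 1 has a normal form, and a normal form
  containing an \<open>H\<^sub>1\<close>-syllable has nontrivial value.\<close>

locale generated_group = group G for G :: "('a, 'm) monoid_scheme" (structure) +
  fixes S :: "'a set"
  assumes finite_S: "finite S" and S_carrier: "S \<subseteq> carrier G"
    and generate_S: "generate G S = carrier G"
begin

abbreviation eval_word :: "'a list \<Rightarrow> 'a" where
  "eval_word w \<equiv> foldr (\<otimes>) w \<one>"

definition spells :: "nat \<Rightarrow> 'a \<Rightarrow> bool" where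
  "spells n g \<longleftrightarrow> (\<exists>w. set w \<subseteq> sym_gens G S \<and> length w = n \<and> eval_word w = g)"

abbreviation len :: "'a \<Rightarrow> nat" where
  "len \<equiv> word_length G S"

text \<open>Left-invariant form of the path metric; \<open>cayley_dist_eq\<close> identifies the
  two. Real values avoid truncated subtraction in Gromov products.\<close>

definition d :: "'a \<Rightarrow> 'a \<Rightarrow> real" where
  "d u v = real (len (inv u \<otimes> v))"

lemma cancel_left [simp]:
  assumes "u \<in> carrier G" "v \<in> carrier G"
  shows "inv u \<otimes> (u \<otimes> v) = v" "u \<otimes> (inv u \<otimes> v) = v"
proof -
  have "inv u \<otimes> (u \<otimes> v) = (inv u \<otimes> u) \<otimes> v" "u \<otimes> (inv u \<otimes> v) = (u \<otimes> inv u) \<otimes> v"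
    using assms by (simp_all only: m_assoc inv_closed)
  then show "inv u \<otimes> (u \<otimes> v) = v" "u \<otimes> (inv u \<otimes> v) = v" using assms by simp_all
qed

lemma sym_gens_carrier: "sym_gens G S \<subseteq> carrier G"
  using S_carrier by (auto simp: sym_gens_def)

lemma sym_gens_inv: "x \<in> sym_gens G S \<Longrightarrow> inv x \<in> sym_gens G S"
  using S_carrier by (auto simp: sym_gens_def)

lemma eval_word_closed: "set w \<subseteq> carrier G \<Longrightarrow> eval_word w \<in> carrier G"
  by (induction w) auto

lemma eval_word_append:
  "set u \<subseteq> carrier G \<Longrightarrow> set v \<subseteq> carrier G \<Longrightarrow> eval_word (u @ v) = eval_word u \<otimes> eval_word v"
  by (induction u) (auto simp: eval_word_closed m_assoc)

lemma spells_closed: "spells n g \<Longrightarrow> g \<in> carrier G"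
  using sym_gens_carrier eval_word_closed unfolding spells_def by blast

lemma spells_0: "spells 0 g \<longleftrightarrow> g = \<one>"
  by (auto simp: spells_def)

lemma spells_mult:
  assumes "spells m g" "spells n h"
  shows "spells (m + n) (g \<otimes> h)"
proof -
  obtain u v where "set u \<subseteq> sym_gens G S" "length u = m" "eval_word u = g"
    "set v \<subseteq> sym_gens G S" "length v = n" "eval_word v = h"
    using assms by (auto simp: spells_def)
  then show ?thesis unfolding spells_def
    using eval_word_append[of u v] sym_gens_carrier by (intro exI[of _ "u @ v"]) auto
qed

lemma spells_gen: "x \<in> sym_gens G S \<Longrightarrow> spells 1 x"
  unfolding spells_def using sym_gens_carrier by (intro exI[of _ "[x]"]) auto

lemma spells_inv: "spells n g \<Longrightarrow> spells n (inv g)"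
proof -
  assume "spells n g"
  then obtain w where "set w \<subseteq> sym_gens G S" "length w = n" "eval_word w = g"
    by (auto simp: spells_def)
  then show ?thesis
  proof (induction w arbitrary: n g)
    case Nil
    then show ?case by (auto simp: spells_0)
  next
    case (Cons x w)
    have x: "x \<in> sym_gens G S" and w: "set w \<subseteq> sym_gens G S" using Cons.prems by auto
    have c: "x \<in> carrier G" "eval_word w \<in> carrier G"
      using x w sym_gens_carrier by (auto intro!: eval_word_closed)
    have "spells (length w + 1) (inv (eval_word w) \<otimes> inv x)"
      using Cons.IH[OF w] spells_gen[OF sym_gens_inv[OF x]] by (intro spells_mult) auto
    then show ?case using Cons.prems c by (auto simp: inv_mult_group)
  qed
qed

lemma spells_exists:
  assumes "g \<in> carrier G"
  shows "\<exists>n. spells n g"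
proof -
  have "g \<in> generate G S" using assms generate_S by simp
  then show ?thesis
  proof induction
    case one
    then show ?case using spells_0 by blast
  next
    case (incl h)
    then show ?case using spells_gen[of h] by (auto simp: sym_gens_def)
  next
    case (inv h)
    then show ?case using spells_gen[of "inv h"] by (auto simp: sym_gens_def)
  next
    case (eng h1 h2)
    then show ?case using spells_mult by blast
  qed
qed

lemma len_least: "len g = (LEAST n. spells n g)"
  by (simp add: word_length_def spells_def)

lemma spells_len: "g \<in> carrier G \<Longrightarrow> spells (len g) g"
  unfolding len_least using spells_exists by (metis LeastI)

lemma len_le: "spells n g \<Longrightarrow> len g \<le> n"
  unfolding len_least by (rule Least_le)

lemma len_one: "len \<one> = 0"
  using len_le[of 0 \<one>] by (simp add: spells_0)

lemma len_eq_0: "g \<in> carrier G \<Longrightarrow> len g = 0 \<Longrightarrow> g = \<one>"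
  using spells_len[of g] by (simp add: spells_0)

lemma len_mult: "g \<in> carrier G \<Longrightarrow> h \<in> carrier G \<Longrightarrow> len (g \<otimes> h) \<le> len g + len h"
  by (intro len_le spells_mult spells_len)

lemma len_inv: "g \<in> carrier G \<Longrightarrow> len (inv g) = len g"
  using len_le[OF spells_inv[OF spells_len]] by (metis inv_closed inv_inv le_antisym)

lemma len_split:
  assumes "g \<in> carrier G" "n \<le> len g"
  shows "\<exists>a b. a \<in> carrier G \<and> b \<in> carrier G \<and> g = a \<otimes> b \<and> len a = n \<and> len b = len g - n"
proof -
  obtain w where w: "set w \<subseteq> sym_gens G S" "length w = len g" "eval_word w = g"
    using spells_len[OF assms(1)] by (auto simp: spells_def)
  let ?a = "eval_word (take n w)" and ?b = "eval_word (drop n w)"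
  have sub: "set (take n w) \<subseteq> sym_gens G S" "set (drop n w) \<subseteq> sym_gens G S"
    using w(1) set_take_subset set_drop_subset by fast+
  have g: "g = ?a \<otimes> ?b"
    using eval_word_append[of "take n w" "drop n w"] sub sym_gens_carrier w(3) by auto
  have a: "spells n ?a" and b: "spells (len g - n) ?b"
    using sub w(2) assms(2) by (auto simp: spells_def)
  then have "len ?a \<le> n" "len ?b \<le> len g - n" "len g \<le> len ?a + len ?b"
    using len_le len_mult g spells_closed by metis+
  then show ?thesis using g spells_closed[OF a] spells_closed[OF b] assms(2)
    by (intro exI[of _ ?a] exI[of _ ?b]) auto
qed

text \<open>A finite alphabet has finitely many words of bounded length. This is the finiteness
  behind the pigeonhole argument in \<open>overlap\<close>.\<close>

lemma finite_len_ball: "finite {g \<in> carrier G. real (len g) \<le> R}"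
proof -
  let ?W = "{w. set w \<subseteq> sym_gens G S \<and> length w \<le> nat \<lfloor>R\<rfloor>}"
  have "finite (sym_gens G S)" using finite_S by (simp add: sym_gens_def)
  then have "finite (eval_word ` ?W)" by (intro finite_imageI finite_lists_length_le)
  moreover have "{g \<in> carrier G. real (len g) \<le> R} \<subseteq> eval_word ` ?W"
  proof safe
    fix g assume g: "g \<in> carrier G" "real (len g) \<le> R"
    obtain w where w: "set w \<subseteq> sym_gens G S" "length w = len g" "eval_word w = g"
      using spells_len[OF g(1)] by (auto simp: spells_def)
    have "len g \<le> nat \<lfloor>R\<rfloor>" using g(2) by linarith
    then show "g \<in> eval_word ` ?W" using w by auto
  qed
  ultimately show ?thesis by (rule rev_finite_subset)
qed

lemma d_nonneg: "d u v \<ge> 0"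
  by (simp add: d_def)

lemma d_refl: "u \<in> carrier G \<Longrightarrow> d u u = 0"
  by (simp add: d_def len_one)

lemma d_sym: "u \<in> carrier G \<Longrightarrow> v \<in> carrier G \<Longrightarrow> d u v = d v u"
  using len_inv[of "inv u \<otimes> v"] by (simp add: d_def inv_mult_group)

lemma d_triangle:
  assumes "u \<in> carrier G" "v \<in> carrier G" "w \<in> carrier G"
  shows "d u w \<le> d u v + d v w"
proof -
  have "inv u \<otimes> w = (inv u \<otimes> v) \<otimes> (inv v \<otimes> w)"
    using assms by (simp add: m_assoc)
  then show ?thesis using len_mult[of "inv u \<otimes> v" "inv v \<otimes> w"] assms by (simp add: d_def)
qed

lemma d_eq_0:
  assumes "u \<in> carrier G" "v \<in> carrier G" "d u v = 0"
  shows "u = v"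
proof -
  have "inv u \<otimes> v = \<one>" using len_eq_0[of "inv u \<otimes> v"] assms by (simp add: d_def)
  then show ?thesis using cancel_left(2)[of u v] assms by simp
qed

lemma d_left_mult:
  assumes "g \<in> carrier G" "u \<in> carrier G" "v \<in> carrier G"
  shows "d (g \<otimes> u) (g \<otimes> v) = d u v"
proof -
  have "inv (g \<otimes> u) \<otimes> (g \<otimes> v) = inv u \<otimes> (inv g \<otimes> (g \<otimes> v))"
    using assms by (simp add: inv_mult_group m_assoc)
  also have "\<dots> = inv u \<otimes> v" using assms by simp
  finally show ?thesis by (simp add: d_def)
qed

lemma d_one: "g \<in> carrier G \<Longrightarrow> d \<one> g = real (len g)"
  by (simp add: d_def)

text \<open>Equality in the triangle inequality: \<open>p\<close> is a vertex of some geodesic from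
  \<open>u\<close> to \<open>v\<close>. It replaces edge paths in all later arguments and is
  compatible with left translation.\<close>

definition btw :: "'a \<Rightarrow> 'a \<Rightarrow> 'a \<Rightarrow> bool" where
  "btw u p v \<longleftrightarrow> p \<in> carrier G \<and> d u p + d p v = d u v"

lemma btw_exists:
  assumes "u \<in> carrier G" "v \<in> carrier G" "real n \<le> d u v"
  shows "\<exists>p. btw u p v \<and> d u p = real n"
proof -
  obtain a b where ab: "a \<in> carrier G" "b \<in> carrier G" "inv u \<otimes> v = a \<otimes> b" "len a = n"
    "len b = len (inv u \<otimes> v) - n"
    using len_split[of "inv u \<otimes> v" n] assms by (auto simp: d_def)
  have p: "u \<otimes> a \<in> carrier G" and v: "v = (u \<otimes> a) \<otimes> b"
    using cancel_left(2)[of u v] ab(1-3) assms(1,2) by (simp_all add: m_assoc)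
  have "inv u \<otimes> (u \<otimes> a) = a" "inv (u \<otimes> a) \<otimes> v = b"
    unfolding v using ab(1,2) assms(1) p by simp_all
  then have "d u (u \<otimes> a) = real n" "d (u \<otimes> a) v = real (len b)"
    using ab(4) by (simp_all add: d_def)
  moreover have "real (len b) = d u v - real n"
    using ab(5) assms(3) by (simp add: d_def)
  ultimately show ?thesis using p by (intro exI[of _ "u \<otimes> a"]) (simp add: btw_def)
qed

lemma btw_sym: "u \<in> carrier G \<Longrightarrow> v \<in> carrier G \<Longrightarrow> btw u p v \<Longrightarrow> btw v p u"
  by (auto simp: btw_def d_sym)

lemma btw_left: "u \<in> carrier G \<Longrightarrow> btw u u v" and btw_right: "v \<in> carrier G \<Longrightarrow> btw u v v"
  by (auto simp: btw_def d_refl)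

lemma btw_left_mult:
  "g \<in> carrier G \<Longrightarrow> u \<in> carrier G \<Longrightarrow> v \<in> carrier G \<Longrightarrow> btw u p v \<Longrightarrow> btw (g \<otimes> u) (g \<otimes> p) (g \<otimes> v)"
  by (auto simp: btw_def d_left_mult)

section \<open>Edge paths of the Cayley graph in terms of the word metric\<close>

sublocale cay: wf_digraph "cayley G S"
  using sym_gens_carrier by unfold_locales (auto simp: cayley_def)

lemma awalk_Nil: "cay.awalk u [] v \<longleftrightarrow> u = v \<and> u \<in> carrier G"
  using cay.awalk_Nil_iff[of u v] by (simp add: cayley_def)

lemma awalk_Cons:
  "cay.awalk u (e # p) v \<longleftrightarrow>
     e \<in> carrier G \<times> sym_gens G S \<and> u = fst e \<and> cay.awalk (fst e \<otimes> snd e) p v"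
  using cay.awalk_Cons_iff[of u e p v] by (simp add: cayley_def case_prod_beta)

lemma awalk_eval:
  "cay.awalk u p v \<Longrightarrow>
     u \<in> carrier G \<and> set (map snd p) \<subseteq> sym_gens G S \<and> v = u \<otimes> eval_word (map snd p)"
proof (induction p arbitrary: u)
  case Nil
  then show ?case by (auto simp: awalk_Nil)
next
  case (Cons e p)
  have e: "e \<in> carrier G \<times> sym_gens G S" "u = fst e"
    and w: "cay.awalk (fst e \<otimes> snd e) p v"
    using Cons.prems by (auto simp: awalk_Cons)
  note ih = Cons.IH[OF w]
  have "set (map snd p) \<subseteq> carrier G" "snd e \<in> carrier G"
    using e ih sym_gens_carrier by auto
  then have "snd e \<in> carrier G" "eval_word (map snd p) \<in> carrier G"
    using eval_word_closed by blast+
  then show ?case using e ih by (auto simp: m_assoc)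
qed

lemma awalk_exists:
  "u \<in> carrier G \<Longrightarrow> set w \<subseteq> sym_gens G S \<Longrightarrow>
     \<exists>p. cay.awalk u p (u \<otimes> eval_word w) \<and> length p = length w"
proof (induction w arbitrary: u)
  case Nil
  then show ?case by (auto simp: awalk_Nil)
next
  case (Cons x w)
  have x: "x \<in> sym_gens G S" "x \<in> carrier G" and w: "eval_word w \<in> carrier G"
    using Cons.prems sym_gens_carrier by (auto intro!: eval_word_closed)
  obtain p where "cay.awalk (u \<otimes> x) p (u \<otimes> x \<otimes> eval_word w)" "length p = length w"
    using Cons.IH[of "u \<otimes> x"] Cons.prems x by auto
  then show ?case using Cons.prems x w
    by (intro exI[of _ "(u, x) # p"]) (auto simp: awalk_Cons m_assoc)
qed

lemma awalk_carrier: "cay.awalk u p v \<Longrightarrow> u \<in> carrier G \<and> v \<in> carrier G"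
  using cay.awalk_hd_in_verts[of u p v] cay.awalk_last_in_verts[of u p v] by (simp add: cayley_def)

lemma d_le_awalk:
  assumes "cay.awalk u p v"
  shows "d u v \<le> real (length p)"
proof -
  note e = awalk_eval[OF assms]
  have "eval_word (map snd p) \<in> carrier G" using e sym_gens_carrier by (intro eval_word_closed) blast
  then have "inv u \<otimes> v = eval_word (map snd p)" using e by simp
  then have "spells (length p) (inv u \<otimes> v)" using e by (auto simp: spells_def intro!: exI[of _ "map snd p"])
  then show ?thesis using len_le by (simp add: d_def)
qed

lemma shortest_awalk:
  assumes "u \<in> carrier G" "v \<in> carrier G"
  shows "\<exists>p. cay.awalk u p v \<and> real (length p) = d u v"
proof -
  obtain w where w: "set w \<subseteq> sym_gens G S" "length w = len (inv u \<otimes> v)" "eval_word w = inv u \<otimes> v"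
    using spells_len[of "inv u \<otimes> v"] assms by (auto simp: spells_def)
  have "v = u \<otimes> eval_word w" using w assms by simp
  then show ?thesis using awalk_exists[OF assms(1) w(1)] w(2) by (auto simp: d_def)
qed

lemma cayley_dist_eq:
  assumes "u \<in> carrier G" "v \<in> carrier G"
  shows "real (cayley_dist G S u v) = d u v"
proof -
  obtain p where p: "cay.awalk u p v" "real (length p) = d u v" using shortest_awalk[OF assms] by auto
  have "cayley_dist G S u v = length p" unfolding cayley_dist_def
    using p d_le_awalk by (intro Least_equality) force+
  then show ?thesis using p by simp
qed

lemma geodesic_iff: "geodesic G S u p v \<longleftrightarrow> cay.awalk u p v \<and> real (length p) = d u v"
proof
  assume g: "geodesic G S u p v"
  then have p: "cay.awalk u p v" and min: "\<And>q. cay.awalk u q v \<Longrightarrow> length p \<le> length q"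
    by (auto simp: geodesic_def)
  obtain q where "cay.awalk u q v" "real (length q) = d u v"
    using shortest_awalk awalk_carrier[OF p] by blast
  then show "cay.awalk u p v \<and> real (length p) = d u v"
    using p d_le_awalk[OF p] min[of q] by auto
next
  assume "cay.awalk u p v \<and> real (length p) = d u v"
  then show "geodesic G S u p v" unfolding geodesic_def using d_le_awalk by force
qed

lemma geodesic_exists: "u \<in> carrier G \<Longrightarrow> v \<in> carrier G \<Longrightarrow> \<exists>p. geodesic G S u p v"
  using shortest_awalk by (simp add: geodesic_iff)

lemma geodesic_btw:
  assumes "geodesic G S u p v" "x \<in> path_verts G S u p"
  shows "btw u x v"
proof -
  have p: "cay.awalk u p v" "real (length p) = d u v" using assms by (auto simp: geodesic_iff)
  obtain q r where qr: "p = q @ r" "cay.awalk u q x" "cay.awalk x r v"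
    using cay.awalk_decomp[OF p(1)] assms(2) unfolding path_verts_def by blast
  have "u \<in> carrier G" "x \<in> carrier G" "v \<in> carrier G"
    using awalk_carrier qr by blast+
  then show ?thesis
    using d_le_awalk[OF qr(2)] d_le_awalk[OF qr(3)] d_triangle[of u x v] p(2) qr(1)
    by (auto simp: btw_def)
qed

lemma btw_geodesic:
  assumes "u \<in> carrier G" "v \<in> carrier G" "btw u x v"
  shows "\<exists>p. geodesic G S u p v \<and> x \<in> path_verts G S u p"
proof -
  have x: "x \<in> carrier G" using assms by (simp add: btw_def)
  obtain q where q: "cay.awalk u q x" "real (length q) = d u x"
    using shortest_awalk assms(1) x by blast
  obtain r where r: "cay.awalk x r v" "real (length r) = d x v"
    using shortest_awalk assms(2) x by blast
  have "cay.awalk u (q @ r) v" using q r by (blast intro: cay.awalk_appendI)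
  moreover have "x \<in> path_verts G S u (q @ r)"
    using cay.set_awalk_verts_append[OF q(1) r(1)] cay.hd_in_awalk_verts(1)[OF r(1)]
    by (simp add: path_verts_def)
  ultimately show ?thesis using q r assms(3)
    by (intro exI[of _ "q @ r"]) (simp add: geodesic_iff btw_def)
qed

lemma quasiconvex_with_iff:
  assumes "H \<subseteq> carrier G"
  shows "quasiconvex_with G S \<mu> H \<longleftrightarrow>
    (\<forall>a\<in>H. \<forall>b\<in>H. \<forall>p. btw a p b \<longrightarrow> (\<exists>s\<in>H. d p s \<le> \<mu>))"
proof
  assume q: "quasiconvex_with G S \<mu> H"
  show "\<forall>a\<in>H. \<forall>b\<in>H. \<forall>p. btw a p b \<longrightarrow> (\<exists>s\<in>H. d p s \<le> \<mu>)"
  proof (intro ballI allI impI)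
    fix a b x assume ab: "a \<in> H" "b \<in> H" "btw a x b"
    obtain p where "geodesic G S a p b" "x \<in> path_verts G S a p"
      using btw_geodesic[of a b x] ab assms by auto
    then have "x \<in> nbhd G S \<mu> H" using q ab by (auto simp: quasiconvex_with_def)
    then obtain s where "s \<in> H" "x \<in> carrier G" "real (cayley_dist G S x s) \<le> \<mu>"
      by (auto simp: nbhd_def)
    then show "\<exists>s\<in>H. d x s \<le> \<mu>" using assms cayley_dist_eq[of x s] by (metis subsetD)
  qed
next
  assume *: "\<forall>a\<in>H. \<forall>b\<in>H. \<forall>p. btw a p b \<longrightarrow> (\<exists>s\<in>H. d p s \<le> \<mu>)"
  show "quasiconvex_with G S \<mu> H" unfolding quasiconvex_with_def
  proof (intro ballI allI impI subsetI)
    fix a b p x assume ab: "a \<in> H" "b \<in> H" "geodesic G S a p b" "x \<in> path_verts G S a p"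
    then have "btw a x b" using geodesic_btw by blast
    then obtain s where s: "s \<in> H" "d x s \<le> \<mu>" using * ab by blast
    have x: "x \<in> carrier G" using \<open>btw a x b\<close> by (simp add: btw_def)
    then have "real (cayley_dist G S x s) \<le> \<mu>" using assms s cayley_dist_eq[of x s] by auto
    then show "x \<in> nbhd G S \<mu> H" using s x unfolding nbhd_def by blast
  qed
qed

text \<open>The curvature condition speaks of every geodesic triangle, so one side may be chosen
  through \<open>x\<close> and the other two arbitrarily.\<close>

lemma negatively_curved_thin:
  assumes nc: "negatively_curved G S \<delta>" and abc: "a \<in> carrier G" "b \<in> carrier G" "c \<in> carrier G"
    and x: "btw a x b"
  shows "\<exists>y. (btw a y c \<or> btw b y c) \<and> d x y \<le> \<delta>"
proof -
  obtain p where p: "geodesic G S a p b" "x \<in> path_verts G S a p"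
    using btw_geodesic[OF abc(1,2) x] by blast
  obtain q where q: "geodesic G S b q c" using geodesic_exists[OF abc(2,3)] by blast
  obtain r where r: "geodesic G S c r a" using geodesic_exists[OF abc(3,1)] by blast
  have "path_verts G S a p \<subseteq> nbhd G S \<delta> (path_verts G S b q \<union> path_verts G S c r)"
    using nc[unfolded negatively_curved_def, rule_format, OF conjI[OF p(1) conjI[OF q r]]] by simp
  then have "x \<in> nbhd G S \<delta> (path_verts G S b q \<union> path_verts G S c r)" using p(2) by blast
  then obtain y where y: "y \<in> path_verts G S b q \<or> y \<in> path_verts G S c r"
    "real (cayley_dist G S x y) \<le> \<delta>" "x \<in> carrier G"
    unfolding nbhd_def by blast
  have b: "btw b y c \<or> btw c y a"
    using y(1) geodesic_btw[OF q, of y] geodesic_btw[OF r, of y] by blast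
  then have "y \<in> carrier G" unfolding btw_def by blast
  then have "d x y \<le> \<delta>" using y cayley_dist_eq[of x y] by simp
  moreover have "btw a y c \<or> btw b y c" using b btw_sym[OF abc(3,1)] by blast
  ultimately show ?thesis by blast
qed

end

section \<open>Gromov products\<close>

context generated_group
begin

text \<open>The Gromov product (x|y)_w, base point first. Up to a bounded error it is the distance
  from \<open>w\<close> to a geodesic from \<open>x\<close> to \<open>y\<close>; see
  \<open>gp_le_dist_side\<close> and \<open>side_near_vertex\<close>.\<close>

definition gp :: "'a \<Rightarrow> 'a \<Rightarrow> 'a \<Rightarrow> real" where
  "gp w x y = (d w x + d w y - d x y) / 2"

lemma gp_sym: "x \<in> carrier G \<Longrightarrow> y \<in> carrier G \<Longrightarrow> gp w x y = gp w y x"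
  by (simp add: gp_def d_sym)

lemma gp_le: "w \<in> carrier G \<Longrightarrow> x \<in> carrier G \<Longrightarrow> y \<in> carrier G \<Longrightarrow> gp w x y \<le> d w x"
  using d_triangle[of w x y] by (simp add: gp_def)

text \<open>The products at the two ends of a side add up to its length, so a small product at one
  end of a long side forces a large one at the other.\<close>

lemma gp_compl:
  "w \<in> carrier G \<Longrightarrow> x \<in> carrier G \<Longrightarrow> y \<in> carrier G \<Longrightarrow> gp w x y = d w x - gp x w y"
  using d_sym[of w x] by (simp add: gp_def field_simps)

lemma gp_left_mult:
  "g \<in> carrier G \<Longrightarrow> w \<in> carrier G \<Longrightarrow> x \<in> carrier G \<Longrightarrow> y \<in> carrier G \<Longrightarrow>
     gp (g \<otimes> w) (g \<otimes> x) (g \<otimes> y) = gp w x y"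
  by (simp add: gp_def d_left_mult)

end

section \<open>Thin triangles and the four-point inequality\<close>

locale hyperbolic_group = generated_group +
  fixes \<delta> :: real
  assumes \<delta>_nonneg: "\<delta> \<ge> 0" and curved: "negatively_curved G S \<delta>"
begin

lemma thin:
  "a \<in> carrier G \<Longrightarrow> b \<in> carrier G \<Longrightarrow> c \<in> carrier G \<Longrightarrow> btw a x b \<Longrightarrow>
     \<exists>y. (btw a y c \<or> btw b y c) \<and> d x y \<le> \<delta>"
  by (rule negatively_curved_thin[OF curved])

text \<open>Among the vertices between \<open>x\<close> and \<open>y\<close> that are \<delta>-close
  to a geodesic from \<open>x\<close> to \<open>w\<close>, take one farthest from \<open>x\<close>.
  Its successor towards \<open>y\<close> must be close to a geodesic from \<open>y\<close> to
  \<open>w\<close>, so the vertex is close to both other sides.\<close>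

lemma side_near_vertex:
  assumes "w \<in> carrier G" "x \<in> carrier G" "y \<in> carrier G"
  shows "\<exists>p. btw x p y \<and> d w p \<le> gp w x y + 2 * \<delta> + 1"
proof -
  define P where "P n \<longleftrightarrow> (\<exists>p u. btw x p y \<and> d x p = real n \<and> btw x u w \<and> d p u \<le> \<delta>)" for n :: nat
  have P0: "P 0" unfolding P_def
    using assms \<delta>_nonneg by (intro exI[of _ x]) (auto simp: btw_left d_refl)
  have bound: "n \<le> len (inv x \<otimes> y)" if "P n" for n
  proof -
    have "\<exists>p. btw x p y \<and> d x p = real n" using that unfolding P_def by blast
    then obtain p where "btw x p y" "d x p = real n" by blast
    then have "real n \<le> d x y" using d_nonneg[of p y] by (auto simp: btw_def)
    then show ?thesis by (simp add: d_def)
  qed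
  define n where "n = (GREATEST n. P n)"
  have n: "P n" unfolding n_def by (rule GreatestI_nat[where P = P, OF P0]) (use bound in blast)
  have max: "m \<le> n" if "P m" for m
    unfolding n_def by (rule Greatest_le_nat[where P = P, OF that]) (use bound in blast)
  obtain p u where p: "btw x p y" "d x p = real n" "btw x u w" "d p u \<le> \<delta>"
    using n unfolding P_def by blast
  have c: "p \<in> carrier G" "u \<in> carrier G" using p by (auto simp: btw_def)
  have "\<exists>p' v. btw x p' y \<and> d p p' \<le> 1 \<and> btw y v w \<and> d p' v \<le> \<delta>"
  proof (cases "d p y = 0")
    case True
    then have "p = y" using d_eq_0 c assms by blast
    then show ?thesis using p(1) assms \<delta>_nonneg
      by (intro exI[of _ y]) (auto simp: btw_left d_refl)
  next
    case False
    then have "real 1 \<le> d p y" by (simp add: d_def)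
    then obtain p' where p': "btw p p' y" "d p p' = 1"
      using btw_exists[of p y 1] c assms by auto
    have c': "p' \<in> carrier G" using p' by (auto simp: btw_def)
    have "d x y \<le> d x p' + d p' y" "d x p' \<le> d x p + d p p'"
      using d_triangle c c' assms by blast+
    then have p'2: "btw x p' y" "d x p' = real (Suc n)"
      using p p' by (auto simp: btw_def)
    obtain v where v: "btw x v w \<or> btw y v w" "d p' v \<le> \<delta>"
      using thin[OF assms(2,3,1) p'2(1)] by blast
    have "\<not> P (Suc n)" using max[of "Suc n"] by auto
    then have "btw y v w" using v p'2 unfolding P_def by blast
    then show ?thesis using p'2 p' v by (intro exI[of _ p'] exI[of _ v]) auto
  qed
  then obtain p' v where q: "btw x p' y" "d p p' \<le> 1" "btw y v w" "d p' v \<le> \<delta>" by blast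
  have c': "p' \<in> carrier G" "v \<in> carrier G" using q by (auto simp: btw_def)
  have "d w p \<le> d w u + d u p" "d x p \<le> d x u + d u p" "d w p \<le> d w p' + d p' p"
    "d w p' \<le> d w v + d v p'" "d y p' \<le> d y v + d v p'" "d y p \<le> d y p' + d p' p"
    using d_triangle c c' assms by blast+
  moreover have "d u p = d p u" "d v p' = d p' v" "d p' p = d p p'" "d u w = d w u" "d v w = d w v"
    "d y p = d p y" "d x w = d w x" "d y w = d w y"
    using d_sym c c' assms by blast+
  moreover have "d x u + d u w = d x w" "d y v + d v w = d y w" "d x p + d p y = d x y"
    using p q by (auto simp: btw_def)
  \<comment> \<open>Via \<open>u\<close>, \<open>d w p\<close> is at most
    \<open>d w x - d x p + 2 * \<delta>\<close>; via \<open>p'\<close> and \<open>v\<close> it is at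
    most \<open>d w y - d y p + 2 * \<delta> + 2\<close>. The mean of the two is the claim.\<close>
  ultimately have "d w p \<le> gp w x y + 2 * \<delta> + 1" unfolding gp_def using p q by argo
  then show ?thesis using p(1) by blast
qed

lemma gp_le_dist_side:
  assumes "w \<in> carrier G" "x \<in> carrier G" "y \<in> carrier G" "btw x p y"
  shows "gp w x y \<le> d w p"
proof -
  have p: "p \<in> carrier G" "d x p + d p y = d x y" using assms by (auto simp: btw_def)
  have "d w x \<le> d w p + d p x" "d w y \<le> d w p + d p y" using d_triangle p assms by blast+
  then show ?thesis using d_sym[of x p] p assms by (simp add: gp_def)
qed

text \<open>The error of \<open>side_near_vertex\<close> plus one \<delta> for passing to another
  side of a thin triangle, as in \<open>gromov\<close>.\<close>

definition \<Delta> :: real where "\<Delta> = 3 * \<delta> + 1"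

lemma \<Delta>_ge: "\<Delta> \<ge> 1" "\<Delta> \<ge> 3 * \<delta>"
  using \<delta>_nonneg by (auto simp: \<Delta>_def)

text \<open>The four-point inequality, with the minimum of two products written as a disjunction. A
  point between \<open>x\<close> and \<open>z\<close> almost realizes (x|z)_w and is close to a side
  ending at \<open>y\<close>; the distance from \<open>w\<close> to that side bounds the product
  belonging to it.\<close>

lemma gromov:
  assumes "w \<in> carrier G" "x \<in> carrier G" "y \<in> carrier G" "z \<in> carrier G"
  shows "gp w x y \<le> gp w x z + \<Delta> \<or> gp w y z \<le> gp w x z + \<Delta>"
proof -
  obtain p where p: "btw x p z" "d w p \<le> gp w x z + 2 * \<delta> + 1"
    using side_near_vertex[OF assms(1,2,4)] by blast
  obtain q where q: "btw x q y \<or> btw z q y" "d p q \<le> \<delta>" using thin[OF assms(2,4,3) p(1)] by blast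
  have c: "p \<in> carrier G" "q \<in> carrier G" using p q by (auto simp: btw_def)
  have "d w q \<le> d w p + d p q" using d_triangle c assms by blast
  then have dq: "d w q \<le> gp w x z + \<Delta>" using p q by (simp add: \<Delta>_def)
  have "gp w x y \<le> d w q \<or> gp w z y \<le> d w q"
    using q gp_le_dist_side assms by blast
  then show ?thesis using dq gp_sym[of z y w] assms by auto
qed

text \<open>Here (u|x)_w and (y|v)_w both equal \<open>t\<close>, so two uses of
  \<open>gromov\<close> give (u|v)_w at least \<open>t - 2 * \<Delta>\<close>, while
  \<open>d u v\<close> is 2t - 2(u|v)_w.\<close>

lemma fellow_travel:
  assumes "w \<in> carrier G" "x \<in> carrier G" "y \<in> carrier G" "btw w u x" "btw w v y"
    and "d w u = t" "d w v = t" "t \<le> gp w x y"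
  shows "d u v \<le> 4 * \<Delta>"
proof -
  have c: "u \<in> carrier G" "v \<in> carrier G" using assms by (auto simp: btw_def)
  have "gp w u x = t" "gp w y v = t"
    using assms c d_sym[of y v] by (auto simp: gp_def btw_def)
  moreover have "gp w u x \<le> gp w u v + \<Delta> \<or> gp w x v \<le> gp w u v + \<Delta>"
    "gp w x y \<le> gp w x v + \<Delta> \<or> gp w y v \<le> gp w x v + \<Delta>"
    using gromov assms c by blast+
  ultimately have "t \<le> gp w u v + 2 * \<Delta>" using assms(8) \<Delta>_ge by argo
  then show ?thesis using assms(6,7) by (simp add: gp_def field_simps)
qed

section \<open>Overlaps of quasiconvex sets\<close>

text \<open>The number of possible differences between nearby points, times the spacing of the
  sample points. \<rho> is the nearness constant of the second set, which exceeds \<mu> when that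
  set is a translate k \<open>H\<close>.\<close>

definition overlap_bound :: "real \<Rightarrow> real \<Rightarrow> real" where
  "overlap_bound \<mu> \<rho> =
     real (card {g \<in> carrier G. real (len g) \<le> \<mu> + 4 * \<Delta> + \<rho>}) * real (nat \<lfloor>2 * \<mu>\<rfloor> + 1)"

text \<open>Sample both geodesics at \<open>card U + 1\<close> common distances from 1. Up to
  distance (x|y)_1 corresponding samples are \<open>4 * \<Delta>\<close>-close, so all differences
  \<open>inv a \<otimes> b\<close> lie in the ball \<open>U\<close>, and two of them agree.\<close>

lemma overlap:
  assumes xy: "x \<in> carrier G" "y \<in> carrier G" and AB: "A \<subseteq> carrier G" "B \<subseteq> carrier G"
    and \<mu>: "\<mu> \<ge> 0"
    and nearA: "\<And>p. btw \<one> p x \<Longrightarrow> \<exists>a\<in>A. d p a \<le> \<mu>"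
    and nearB: "\<And>p. btw \<one> p y \<Longrightarrow> \<exists>b\<in>B. d p b \<le> \<rho>"
    and long: "overlap_bound \<mu> \<rho> \<le> gp \<one> x y"
  obtains a b a' b' u u' where "a \<in> A" "b \<in> B" "a' \<in> A" "b' \<in> B" "btw \<one> u x" "btw \<one> u' x"
    "d u a \<le> \<mu>" "d u' a' \<le> \<mu>" "d \<one> u + 2 * \<mu> < d \<one> u'" "inv a \<otimes> b = inv a' \<otimes> b'"
proof -
  define U where "U = {g \<in> carrier G. real (len g) \<le> \<mu> + 4 * \<Delta> + \<rho>}"
  define s where "s = nat \<lfloor>2 * \<mu>\<rfloor> + 1"
  \<comment> \<open>This gap survives moving both samples by \<mu> to points of \<open>A\<close>. It
    yields the strict shortening in \<open>corner_coset\<close> and distinct points of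
    \<open>A\<close> in \<open>corner_malnormal\<close>.\<close>
  have s: "real s > 2 * \<mu>" unfolding s_def by linarith
  have fin: "finite U" unfolding U_def by (rule finite_len_ball)
  define Q where "Q j u a b \<longleftrightarrow> btw \<one> u x \<and> d \<one> u = real (j * s) \<and> a \<in> A \<and> b \<in> B \<and>
    d u a \<le> \<mu> \<and> inv a \<otimes> b \<in> U" for j :: nat and u a b
  have ex: "\<exists>u a b. Q j u a b" if j: "j \<le> card U" for j
  proof -
    have "real (j * s) \<le> real (card U * s)" using j by (intro of_nat_mono mult_right_mono) auto
    also have "\<dots> = overlap_bound \<mu> \<rho>"
      unfolding overlap_bound_def U_def s_def by (simp only: of_nat_mult)
    finally have t: "real (j * s) \<le> gp \<one> x y" using long by linarith
    have "real (j * s) \<le> d \<one> x" "real (j * s) \<le> d \<one> y"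
      using t gp_le[of \<one> x y] gp_le[of \<one> y x] gp_sym[of x y \<one>] xy by auto
    then obtain u v where uv: "btw \<one> u x" "d \<one> u = real (j * s)" "btw \<one> v y" "d \<one> v = real (j * s)"
      using btw_exists[OF one_closed] xy by metis
    obtain a b where ab: "a \<in> A" "d u a \<le> \<mu>" "b \<in> B" "d v b \<le> \<rho>"
      using nearA[OF uv(1)] nearB[OF uv(3)] by blast
    have c: "u \<in> carrier G" "v \<in> carrier G" "a \<in> carrier G" "b \<in> carrier G"
      using uv ab AB by (auto simp: btw_def)
    have "d u v \<le> 4 * \<Delta>" using fellow_travel[OF one_closed xy uv(1,3,2,4) t] .
    moreover have "d a b \<le> d a u + d u b" "d u b \<le> d u v + d v b"
      using d_triangle c by blast+
    ultimately have "d a b \<le> \<mu> + 4 * \<Delta> + \<rho>" using ab d_sym[of a u] c by argo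
    then have "inv a \<otimes> b \<in> U" using c by (simp add: U_def d_def)
    then show ?thesis unfolding Q_def using uv ab by blast
  qed
  then obtain u a b where Q: "\<And>j. j \<le> card U \<Longrightarrow> Q j (u j) (a j) (b j)" by metis
  have "\<not> inj_on (\<lambda>j. inv (a j) \<otimes> b j) {..card U}"
  proof
    assume "inj_on (\<lambda>j. inv (a j) \<otimes> b j) {..card U}"
    then have "card {..card U} \<le> card U"
      by (rule card_inj_on_le) (use Q fin in \<open>auto simp: Q_def\<close>)
    then show False by simp
  qed
  then obtain i j where ij: "i < j" "j \<le> card U" "inv (a i) \<otimes> b i = inv (a j) \<otimes> b j"
    unfolding inj_on_def by (metis atMost_iff linorder_neqE_nat)
  have Qi: "Q i (u i) (a i) (b i)" and Qj: "Q j (u j) (a j) (b j)" using Q ij by auto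
  have "real (i * s) + real s \<le> real (j * s)"
  proof -
    have "Suc i * s \<le> j * s" using ij by (intro mult_right_mono) auto
    then have "real (Suc i * s) \<le> real (j * s)" by (rule of_nat_mono)
    then show ?thesis by (simp add: algebra_simps)
  qed
  then have "d \<one> (u i) + 2 * \<mu> < d \<one> (u j)" using s Qi Qj by (simp add: Q_def)
  then show ?thesis using that[of "a i" "b i" "a j" "b j" "u i" "u j"] Qi Qj ij by (auto simp: Q_def)
qed

lemma quotient_eq:
  assumes "a \<in> carrier G" "b \<in> carrier G" "a' \<in> carrier G" "b' \<in> carrier G"
    and "inv a \<otimes> b = inv a' \<otimes> b'"
  shows "a' \<otimes> inv a = b' \<otimes> inv b"
proof -
  have "a' \<otimes> (inv a \<otimes> b) = b'" using assms by simp
  then have "(a' \<otimes> inv a) \<otimes> b = b'" using assms by (simp add: m_assoc)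
  then show ?thesis using assms by (metis inv_closed m_closed inv_solve_right)
qed

text \<open>Equal differences give an element c of \<open>A \<inter> B\<close>. The inverse of s c
  is \<open>a \<otimes> (inv a' \<otimes> inv s)\<close>: the stretch from \<open>u\<close> to
  \<open>u'\<close>, longer than \<open>2 * \<mu>\<close>, is cut out at a cost of at most
  \<open>2 * \<mu>\<close>, so s c is shorter than \<open>s\<close>. Minimality is asked of
  \<open>s\<close> alone, and \<open>t\<close> is arbitrary in \<open>B\<close>.\<close>

lemma corner_coset:
  assumes A: "subgroup A G" "quasiconvex_with G S \<mu> A" and B: "subgroup B G" "quasiconvex_with G S \<mu> B"
    and \<mu>: "\<mu> \<ge> 0" and s: "s \<in> A" and t: "t \<in> B"
    and short: "\<And>c. c \<in> A \<inter> B \<Longrightarrow> len s \<le> len (s \<otimes> c)"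
  shows "gp \<one> (inv s) t < overlap_bound \<mu> \<mu>"
proof (rule ccontr)
  assume "\<not> ?thesis"
  then have long: "overlap_bound \<mu> \<mu> \<le> gp \<one> (inv s) t" by simp
  note sA = subgroup.subset[OF A(1)] and sB = subgroup.subset[OF B(1)]
  have invs: "inv s \<in> A" using A(1) s by (rule subgroup.m_inv_closed)
  have c: "s \<in> carrier G" "inv s \<in> carrier G" "t \<in> carrier G" using s t sA sB by auto
  have nearA: "\<exists>a\<in>A. d p a \<le> \<mu>" if "btw \<one> p (inv s)" for p
    using A(2)[unfolded quasiconvex_with_iff[OF sA]] subgroup.one_closed[OF A(1)] invs that by blast
  have nearB: "\<exists>b\<in>B. d p b \<le> \<mu>" if "btw \<one> p t" for p
    using B(2)[unfolded quasiconvex_with_iff[OF sB]] subgroup.one_closed[OF B(1)] t that by blast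
  obtain a b a' b' u u' where ab: "a \<in> A" "b \<in> B" "a' \<in> A" "b' \<in> B" and u: "btw \<one> u (inv s)"
    "btw \<one> u' (inv s)" "d u a \<le> \<mu>" "d u' a' \<le> \<mu>" "d \<one> u + 2 * \<mu> < d \<one> u'"
    and eq: "inv a \<otimes> b = inv a' \<otimes> b'"
    by (rule overlap[OF c(2,3) sA sB \<mu> nearA nearB long])
  have abc: "a \<in> carrier G" "b \<in> carrier G" "a' \<in> carrier G" "b' \<in> carrier G"
    "u \<in> carrier G" "u' \<in> carrier G"
    using ab sA sB u by (auto simp: btw_def)
  let ?c = "a' \<otimes> inv a"
  have "?c \<in> A" using A(1) ab by (simp add: subgroup.m_closed subgroup.m_inv_closed)
  moreover have "?c \<in> B" unfolding quotient_eq[OF abc(1-4) eq]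
    using B(1) ab by (simp add: subgroup.m_closed subgroup.m_inv_closed)
  ultimately have le: "len s \<le> len (s \<otimes> ?c)" by (intro short) simp
  have "inv (s \<otimes> ?c) = a \<otimes> (inv a' \<otimes> inv s)" using abc c by (simp add: inv_mult_group m_assoc)
  then have "len (s \<otimes> ?c) = len (a \<otimes> (inv a' \<otimes> inv s))"
    using len_inv[of "s \<otimes> ?c"] abc c by simp
  also have "\<dots> \<le> len a + len (inv a' \<otimes> inv s)" using abc c by (intro len_mult) auto
  finally have "real (len (s \<otimes> ?c)) \<le> d \<one> a + d a' (inv s)"
    using abc by (simp add: d_one) (simp add: d_def flip: of_nat_add)
  moreover have "d \<one> a \<le> d \<one> u + d u a" "d a' (inv s) \<le> d a' u' + d u' (inv s)"
    using d_triangle abc c by blast+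
  moreover have "d a' u' = d u' a'" "d \<one> u' + d u' (inv s) = d \<one> (inv s)"
    using d_sym abc u by (auto simp: btw_def)
  moreover have "d \<one> (inv s) = real (len s)" using c by (simp add: d_one len_inv)
  ultimately show False using u le by (smt (verit) of_nat_mono)
qed

text \<open>
  Two overlaps with the same discrepancy would give a nontrivial element of \<open>H \<inter> k H k\<inverse>\<close>.
\<close>

lemma corner_malnormal:
  assumes H: "subgroup H G" "quasiconvex_with G S \<mu> H" "malnormal G H" and \<mu>: "\<mu> \<ge> 0"
    and k: "k \<in> carrier G" "k \<notin> H" "real (len k) \<le> L" and h: "h \<in> H" "h' \<in> H"
  shows "gp \<one> h (k \<otimes> h') < overlap_bound \<mu> (\<delta> + L + \<mu>)"
proof (rule ccontr)
  assume "\<not> ?thesis"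
  then have long: "overlap_bound \<mu> (\<delta> + L + \<mu>) \<le> gp \<one> h (k \<otimes> h')" by simp
  note sH = subgroup.subset[OF H(1)] and oneH = subgroup.one_closed[OF H(1)]
  note qc = H(2)[unfolded quasiconvex_with_iff[OF sH], rule_format]
  have c: "h \<in> carrier G" "h' \<in> carrier G" "k \<otimes> h' \<in> carrier G" using h sH k by auto
  have sB: "(\<lambda>x. k \<otimes> x) ` H \<subseteq> carrier G" using sH k by auto
  have L: "L \<ge> 0" using k(3) by linarith
  \<comment> \<open>The geodesic is \<delta>-close to geodesics from 1 to \<open>k\<close> and from
    \<open>k\<close> to \<open>k \<otimes> h'\<close>. The former stays within \<open>L\<close> of
    \<open>k\<close>; the latter is a translate of a geodesic with both ends in
    \<open>H\<close>.\<close>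
  have nearB: "\<exists>b\<in>(\<lambda>x. k \<otimes> x) ` H. d p b \<le> \<delta> + L + \<mu>" if p: "btw \<one> p (k \<otimes> h')" for p
  proof -
    obtain y where y: "btw \<one> y k \<or> btw (k \<otimes> h') y k" "d p y \<le> \<delta>"
      using thin[OF one_closed c(3) k(1) p] by blast
    have yp: "y \<in> carrier G" "p \<in> carrier G" using y p by (auto simp: btw_def)
    from y(1) show ?thesis
    proof
      assume "btw \<one> y k"
      then have "d y k \<le> L" using k d_nonneg[of \<one> y] d_one[OF k(1)] by (simp add: btw_def)
      then have "d p (k \<otimes> \<one>) \<le> \<delta> + L + \<mu>"
        using d_triangle[of p y k] yp k y \<mu> by simp
      then show ?thesis using oneH by blast
    next
      assume "btw (k \<otimes> h') y k"
      then have "btw (inv k \<otimes> (k \<otimes> h')) (inv k \<otimes> y) (inv k \<otimes> k)"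
        using c k by (intro btw_left_mult) auto
      then have "btw h' (inv k \<otimes> y) \<one>" using c k by simp
      then obtain s where s: "s \<in> H" "d (inv k \<otimes> y) s \<le> \<mu>" using qc[OF h(2) oneH] by blast
      have sc: "s \<in> carrier G" using s sH by blast
      have "d (k \<otimes> (inv k \<otimes> y)) (k \<otimes> s) = d (inv k \<otimes> y) s"
        using k yp sc by (intro d_left_mult) auto
      then have "d y (k \<otimes> s) \<le> \<mu>" using k yp s by simp
      then have "d p (k \<otimes> s) \<le> \<delta> + L + \<mu>"
        using d_triangle[of p y "k \<otimes> s"] yp k y sc L by simp
      then show ?thesis using s by blast
    qed
  qed
  have nearA: "\<exists>a\<in>H. d p a \<le> \<mu>" if "btw \<one> p h" for p
    using qc[OF oneH h(1) that] .
  obtain a b a' b' u u' where ab: "a \<in> H" "b \<in> (\<lambda>x. k \<otimes> x) ` H" "a' \<in> H" "b' \<in> (\<lambda>x. k \<otimes> x) ` H"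
    and u: "btw \<one> u h" "btw \<one> u' h" "d u a \<le> \<mu>" "d u' a' \<le> \<mu>" "d \<one> u + 2 * \<mu> < d \<one> u'"
    and eq: "inv a \<otimes> b = inv a' \<otimes> b'"
    by (rule overlap[OF c(1,3) sH sB \<mu> nearA nearB long])
  have abc: "a \<in> carrier G" "b \<in> carrier G" "a' \<in> carrier G" "b' \<in> carrier G"
    "u \<in> carrier G" "u' \<in> carrier G"
    using ab sH sB u by (auto simp: btw_def)
  obtain r r' where r: "r \<in> H" "r' \<in> H" "b = k \<otimes> r" "b' = k \<otimes> r'" using ab by blast
  have rc: "r \<in> carrier G" "r' \<in> carrier G" using r sH by auto
  have "a' \<otimes> inv a = k \<otimes> (r' \<otimes> inv r) \<otimes> inv k"
    unfolding quotient_eq[OF abc(1-4) eq] r using k rc by (simp add: inv_mult_group m_assoc)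
  moreover have "r' \<otimes> inv r \<in> H" using H(1) r by (simp add: subgroup.m_closed subgroup.m_inv_closed)
  ultimately have "a' \<otimes> inv a \<in> k <# H #> inv k" by (auto simp: l_coset_def r_coset_def)
  moreover have "a' \<otimes> inv a \<in> H" using H(1) ab by (simp add: subgroup.m_closed subgroup.m_inv_closed)
  ultimately have "a' \<otimes> inv a = \<one>" using H(3) k unfolding malnormal_def by blast
  then have "a' = a" using abc by (metis inv_equality inv_inv inv_closed)
  have "d \<one> u' \<le> d \<one> a + d a u'" "d \<one> a \<le> d \<one> u + d u a"
    using d_triangle abc by blast+
  then show False using u d_sym[of a u'] abc unfolding \<open>a' = a\<close> by argo
qed

section \<open>Chains with small Gromov products\<close>

text \<open>If the product at \<open>z (i + 1)\<close> is at most \<open>a + \<Delta>\<close>, the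
  length of the next side makes the complementary product at \<open>z (i + 2)\<close> exceed
  \<open>a + 2 * \<Delta>\<close>, which excludes the first alternative of \<open>gromov\<close>
  there. Only interior sides are required to be long; the first and the last may be arbitrarily
  short.\<close>

lemma chain_gp_le:
  fixes z :: "nat \<Rightarrow> 'a"
  assumes z: "\<And>i. i \<le> n \<Longrightarrow> z i \<in> carrier G"
    and corner: "\<And>i. i + 2 \<le> n \<Longrightarrow> gp (z (i + 1)) (z i) (z (i + 2)) \<le> a"
    and long: "\<And>i. i + 3 \<le> n \<Longrightarrow> d (z (i + 1)) (z (i + 2)) > 2 * a + 3 * \<Delta>"
  shows "i + 2 \<le> n \<Longrightarrow> gp (z (i + 1)) (z 0) (z (i + 2)) \<le> a + \<Delta>"
proof (induction i)
  case 0
  then show ?case using corner[of 0] \<Delta>_ge by simp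
next
  case (Suc i)
  have c: "z 0 \<in> carrier G" "z (i + 1) \<in> carrier G" "z (i + 2) \<in> carrier G" "z (i + 3) \<in> carrier G"
    using Suc.prems by (auto intro: z)
  have "gp (z (i + 2)) (z (i + 1)) (z 0) = d (z (i + 2)) (z (i + 1)) - gp (z (i + 1)) (z (i + 2)) (z 0)"
    using gp_compl c by blast
  also have "\<dots> = d (z (i + 1)) (z (i + 2)) - gp (z (i + 1)) (z 0) (z (i + 2))"
    using gp_sym d_sym c by metis
  finally have "gp (z (i + 2)) (z (i + 1)) (z 0) > a + 2 * \<Delta>"
    using long[of i] Suc by simp
  moreover have "gp (z (i + 2)) (z (i + 1)) (z (i + 3)) \<le> a"
    using corner[of "i + 1"] Suc.prems by (simp add: numeral_3_eq_3 numeral_2_eq_2)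
  moreover have "gp (z (i + 2)) (z (i + 1)) (z 0) \<le> gp (z (i + 2)) (z (i + 1)) (z (i + 3)) + \<Delta> \<or>
    gp (z (i + 2)) (z 0) (z (i + 3)) \<le> gp (z (i + 2)) (z (i + 1)) (z (i + 3)) + \<Delta>"
    using gromov c by blast
  ultimately have "gp (z (i + 2)) (z 0) (z (i + 3)) \<le> a + \<Delta>" using \<Delta>_ge by argo
  then show ?case by (simp add: numeral_3_eq_3 numeral_2_eq_2)
qed

lemma chain_growth:
  fixes z :: "nat \<Rightarrow> 'a"
  assumes z: "\<And>i. i \<le> n \<Longrightarrow> z i \<in> carrier G"
    and corner: "\<And>i. i + 2 \<le> n \<Longrightarrow> gp (z (i + 1)) (z i) (z (i + 2)) \<le> a"
    and long: "\<And>i. i + 3 \<le> n \<Longrightarrow> d (z (i + 1)) (z (i + 2)) > 2 * a + 3 * \<Delta>"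
    and i: "i + 2 \<le> n"
  shows "d (z 0) (z (i + 2)) \<ge> d (z 0) (z (i + 1)) + d (z (i + 1)) (z (i + 2)) - 2 * a - 2 * \<Delta>"
proof -
  have "gp (z (i + 1)) (z 0) (z (i + 2)) \<le> a + \<Delta>"
    by (rule chain_gp_le[where n = n, OF z corner long i])
  moreover have "d (z 0) (z (i + 1)) = d (z (i + 1)) (z 0)" using i by (intro d_sym z) auto
  ultimately show ?thesis by (simp add: gp_def field_simps)
qed

text \<open>The forward bound controls \<open>z 0\<close> against \<open>z (i + 2)\<close>. The same
  bound for the reversed chain shows that \<open>z (i + 2)\<close> and \<open>z n\<close> have a
  large product at \<open>z (i + 1)\<close>, so \<open>z n\<close> may replace
  \<open>z (i + 2)\<close> at the cost of one more \<Delta>.\<close>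

lemma chain_gp_ends:
  fixes z :: "nat \<Rightarrow> 'a"
  assumes z: "\<And>i. i \<le> n \<Longrightarrow> z i \<in> carrier G"
    and corner: "\<And>i. i + 2 \<le> n \<Longrightarrow> gp (z (i + 1)) (z i) (z (i + 2)) \<le> a"
    and long: "\<And>i. i + 3 \<le> n \<Longrightarrow> d (z (i + 1)) (z (i + 2)) > 2 * a + 3 * \<Delta>"
    and i: "i + 2 \<le> n"
  shows "gp (z (i + 1)) (z 0) (z n) \<le> a + 2 * \<Delta>"
proof (cases "i + 2 = n")
  case True
  then show ?thesis using chain_gp_le[where n = n and i = i, OF z corner long] i \<Delta>_ge by force
next
  case False
  then have i3: "i + 3 \<le> n" using i by simp
  have c: "z 0 \<in> carrier G" "z (i + 1) \<in> carrier G" "z (i + 2) \<in> carrier G" "z n \<in> carrier G"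
    using i by (auto intro: z)
  have 1: "gp (z (i + 1)) (z 0) (z (i + 2)) \<le> a + \<Delta>"
    by (rule chain_gp_le[where n = n, OF z corner long i])
  \<comment> \<open>In the reversed chain the corner \<open>z (i + 2)\<close> has index
    \<open>(n - i - 3) + 1\<close>, and its successor is \<open>z (i + 1)\<close>.\<close>
  define y where "y j = z (n - j)" for j
  have "gp (y ((n - i - 3) + 1)) (y 0) (y ((n - i - 3) + 2)) \<le> a + \<Delta>"
  proof (rule chain_gp_le[where n = n])
    fix j assume j: "j + 2 \<le> n"
    then obtain m where m: "n = m + j + 2" by (metis add.assoc add.commute le_Suc_ex)
    have "n - j = m + 2" "n - (j + 1) = m + 1" "n - (j + 2) = m" using m by auto
    moreover have "gp (z (m + 1)) (z (m + 2)) (z m) \<le> a"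
      using corner[of m] gp_sym[of "z m" "z (m + 2)"] m by (simp add: z)
    ultimately show "gp (y (j + 1)) (y j) (y (j + 2)) \<le> a" by (simp only: y_def)
  next
    fix j assume j: "j + 3 \<le> n"
    then obtain m where m: "n = m + j + 3" by (metis add.assoc add.commute le_Suc_ex)
    have "n - (j + 1) = m + 2" "n - (j + 2) = m + 1" using m by auto
    moreover have "d (z (m + 2)) (z (m + 1)) > 2 * a + 3 * \<Delta>"
      using long[of m] d_sym[of "z (m + 1)" "z (m + 2)"] m by (simp add: z)
    ultimately show "d (y (j + 1)) (y (j + 2)) > 2 * a + 3 * \<Delta>" by (simp only: y_def)
  qed (use i3 in \<open>auto simp: y_def intro: z\<close>)
  moreover have "n - (n - i - 3 + 1) = i + 2" "n - (n - i - 3 + 2) = i + 1" using i3 by auto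
  ultimately have 2: "gp (z (i + 2)) (z n) (z (i + 1)) \<le> a + \<Delta>" by (simp add: y_def)
  have "gp (z (i + 1)) (z (i + 2)) (z n) = d (z (i + 1)) (z (i + 2)) - gp (z (i + 2)) (z (i + 1)) (z n)"
    using gp_compl c by blast
  also have "\<dots> = d (z (i + 1)) (z (i + 2)) - gp (z (i + 2)) (z n) (z (i + 1))"
    using gp_sym c by metis
  finally have "gp (z (i + 1)) (z (i + 2)) (z n) > a + 2 * \<Delta>" using 2 long[OF i3] by argo
  moreover have "gp (z (i + 1)) (z 0) (z n) \<le> gp (z (i + 1)) (z 0) (z (i + 2)) + \<Delta> \<or>
      gp (z (i + 1)) (z n) (z (i + 2)) \<le> gp (z (i + 1)) (z 0) (z (i + 2)) + \<Delta>"
    using gromov c by blast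
  ultimately show ?thesis using 1 gp_sym[of "z (i + 2)" "z n" "z (i + 1)"] c by argo
qed

text \<open>Let \<open>z (i + 1)\<close> be the first vertex at least as far from \<open>z 0\<close>
  as \<open>p\<close>. Thin triangles move \<open>p\<close> to the side from \<open>z i\<close> to
  \<open>z (i + 1)\<close>, to a geodesic before \<open>z i\<close>, or to one after
  \<open>z (i + 1)\<close>. In the last two cases comparing distances from \<open>z 0\<close> puts
  \<open>p\<close> near \<open>z i\<close> or \<open>z (i + 1)\<close>.\<close>

lemma chain_near:
  fixes z :: "nat \<Rightarrow> 'a"
  assumes z: "\<And>i. i \<le> n \<Longrightarrow> z i \<in> carrier G"
    and corner: "\<And>i. i + 2 \<le> n \<Longrightarrow> gp (z (i + 1)) (z i) (z (i + 2)) \<le> a"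
    and long: "\<And>i. i + 3 \<le> n \<Longrightarrow> d (z (i + 1)) (z (i + 2)) > 2 * a + 3 * \<Delta>"
    and a: "a \<ge> 0" and n: "n > 0" and p: "btw (z 0) p (z n)"
  shows "\<exists>i<n. \<exists>q. btw (z i) q (z (i + 1)) \<and> d p q \<le> 2 * a + 5 * \<Delta>"
proof -
  have pc: "p \<in> carrier G" using p by (simp add: btw_def)
  define t where "t = d (z 0) p"
  have "t \<le> d (z 0) (z n)" using p d_nonneg[of p "z n"] by (simp add: btw_def t_def)
  then obtain m where m: "t \<le> d (z 0) (z m)" "m \<le> n" and least: "\<And>i. i < m \<Longrightarrow> d (z 0) (z i) < t"
    using exists_least_iff[of "\<lambda>m. t \<le> d (z 0) (z m)"] by (metis not_le leI)
  show ?thesis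
  proof (cases m)
    case 0
    have z0: "z 0 \<in> carrier G" by (intro z) simp
    have "t = 0" using m 0 d_refl[OF z0] d_nonneg[of "z 0" p] by (simp add: t_def)
    then have "p = z 0" using d_eq_0[of "z 0" p] z0 pc by (simp add: t_def)
    then have "d p (z 0) \<le> 2 * a + 5 * \<Delta>" using d_refl[OF z0] a \<Delta>_ge by simp
    then show ?thesis using n btw_left[OF z0, of "z (0 + 1)"] by blast
  next
    case (Suc i)
    have lt: "d (z 0) (z i) < t" and i: "i < n" using least[of i] m Suc by auto
    have c: "z 0 \<in> carrier G" "z i \<in> carrier G" "z (i + 1) \<in> carrier G" "z n \<in> carrier G"
      using i by (auto intro: z)
    have t: "t \<le> d (z 0) (z (i + 1))" using m Suc by simp
    obtain q where q: "btw (z 0) q (z (i + 1)) \<or> btw (z n) q (z (i + 1))" "d p q \<le> \<delta>"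
      using thin[OF c(1,4,3) p] by blast
    have qc: "q \<in> carrier G" using q by (auto simp: btw_def)
    have tri: "t \<le> d (z 0) q + d q p" "d (z 0) q \<le> t + d p q"
      using d_triangle c qc pc unfolding t_def by blast+
    have qp: "d q p = d p q" using d_sym qc pc by blast
    from q(1) show ?thesis
    proof
      assume b: "btw (z 0) q (z (i + 1))"
      obtain r where r: "btw (z 0) r (z i) \<or> btw (z (i + 1)) r (z i)" "d q r \<le> \<delta>"
        using thin[OF c(1,3,2) b] by blast
      have rc: "r \<in> carrier G" using r by (auto simp: btw_def)
      have pr: "d p r \<le> d p q + d q r" using d_triangle pc qc rc by blast
      from r(1) show ?thesis
      proof
        assume br: "btw (z 0) r (z i)"
        \<comment> \<open>\<open>r\<close> is at least \<open>t - 2 * \<delta>\<close> away from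
          \<open>z 0\<close>, but \<open>z i\<close> is less than \<open>t\<close> away, so
          \<open>r\<close> is within \<open>2 * \<delta>\<close> of \<open>z i\<close>.\<close>
        have "d (z 0) q \<le> d (z 0) r + d r q" "d p (z i) \<le> d p r + d r (z i)"
          using d_triangle c pc qc rc by blast+
        then have "d p (z i) \<le> 2 * a + 5 * \<Delta>"
          using br pr tri qp q r lt d_sym[of r q] rc qc a \<Delta>_ge \<delta>_nonneg by (simp add: btw_def)
        then show ?thesis using i btw_left[OF c(2), of "z (i + 1)"] by blast
      next
        assume br: "btw (z (i + 1)) r (z i)"
        have "d p r \<le> 2 * a + 5 * \<Delta>" using pr q r a \<Delta>_ge \<delta>_nonneg by argo
        then show ?thesis using i btw_sym[OF c(3,2) br] by blast
      qed
    next
      assume b: "btw (z n) q (z (i + 1))"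
      \<comment> \<open>Going through \<open>z (i + 1)\<close> is longer than the geodesic by at
        most \<open>2 * (a + 2 * \<Delta>)\<close>; moving between \<open>p\<close> and
        \<open>q\<close> adds \<delta> twice, and \<open>2 * \<delta>\<close> is at most
        \<Delta>.\<close>
      have "d p (z (i + 1)) \<le> 2 * a + 5 * \<Delta>"
      proof (cases "i + 2 \<le> n")
        case True
        have "gp (z (i + 1)) (z 0) (z n) \<le> a + 2 * \<Delta>"
          by (rule chain_gp_ends[where n = n, OF z corner long True])
        moreover have "d (z 0) (z n) \<le> d (z 0) q + d q (z n)" "d p (z (i + 1)) \<le> d p q + d q (z (i + 1))"
          using d_triangle c pc qc by blast+
        moreover have "d q (z n) = d (z n) q" "d (z (i + 1)) (z 0) = d (z 0) (z (i + 1))"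
          "d (z (i + 1)) (z n) = d (z n) (z (i + 1))"
          using d_sym c pc qc by blast+
        ultimately show ?thesis
          using b tri t q qp \<Delta>_ge unfolding gp_def btw_def by argo
      next
        case False
        then have "i + 1 = n" using i by simp
        then have "d q (z (i + 1)) = 0" using b d_sym[of "z n" q] d_refl[of "z n"] d_nonneg[of q "z n"] c qc
          by (simp add: btw_def)
        then show ?thesis using d_triangle[of p q "z (i + 1)"] pc qc c q a \<Delta>_ge \<delta>_nonneg by argo
      qed
      then show ?thesis using i btw_right[OF c(3), of "z i"] by blast
    qed
  qed
qed

end

context hyperbolic_group
begin

text \<open>
  The threshold \<open>2 * overlap_bound \<mu> \<mu> + \<Delta>\<close> separates the syllables \<open>k \<in> K\<close> that are handled by
  malnormality from those so long that the corners at both of their ends are independent.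
\<close>

definition corner_bound :: "real \<Rightarrow> real" where
  "corner_bound \<mu> = max (overlap_bound \<mu> \<mu>)
     (overlap_bound \<mu> (\<delta> + (2 * overlap_bound \<mu> \<mu> + \<Delta>) + \<mu>)) + 2 * \<Delta>"

text \<open>This is the constant of the theorem, fixed before any subgroup is introduced. Joining k
  and h loses at most \<open>2 * overlap_bound \<mu> \<mu>\<close> of |h|, and what remains exceeds
  the side length \<open>2 * a + 3 * \<Delta>\<close> required of chains with corner bound
  \<open>a = corner_bound \<mu>\<close>.\<close>

definition syllable_bound :: "real \<Rightarrow> real" where
  "syllable_bound \<mu> = 2 * overlap_bound \<mu> \<mu> + 2 * corner_bound \<mu> + 4 * \<Delta> + 1"

lemma overlap_bound_nonneg: "overlap_bound \<mu> \<rho> \<ge> 0"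
  by (simp add: overlap_bound_def)

lemma corner_bound_nonneg: "corner_bound \<mu> \<ge> 0"
  using overlap_bound_nonneg[of \<mu> \<mu>] \<Delta>_ge(1) by (simp add: corner_bound_def)

end

section \<open>Normal forms in the amalgam\<close>

locale malnormal_pair = hyperbolic_group +
  fixes \<mu> :: real and H K H\<^sub>1 :: "'a set"
  assumes \<mu>_nonneg: "\<mu> \<ge> 0"
    and H: "subgroup H G" "quasiconvex_with G S \<mu> H" "malnormal G H"
    and K: "subgroup K G" "quasiconvex_with G S \<mu> K"
    and H1: "subgroup H\<^sub>1 G" "H\<^sub>1 \<subseteq> H" "H\<^sub>1 \<inter> K = H \<inter> K"
    and long_syllables: "\<And>h. h \<in> H\<^sub>1 \<Longrightarrow> real (len h) < syllable_bound \<mu> \<Longrightarrow> h \<in> H \<inter> K"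
begin

lemma H_carrier: "h \<in> H \<Longrightarrow> h \<in> carrier G"
  and K_carrier: "k \<in> K \<Longrightarrow> k \<in> carrier G"
  and H1_carrier: "h \<in> H\<^sub>1 \<Longrightarrow> h \<in> carrier G"
  using subgroup.mem_carrier H(1) K(1) H1(1) by metis+

lemma G0_subset: "c \<in> H \<inter> K \<Longrightarrow> c \<in> H\<^sub>1"
  using H1(3) by blast

text \<open>Minimality in the coset g (\<open>H \<inter> K\<close>): the correcting factor stands on
  the right, where the next syllable can absorb it.\<close>

definition coset_short :: "'a \<Rightarrow> bool" where
  "coset_short g \<longleftrightarrow> (\<forall>c \<in> H \<inter> K. len g \<le> len (g \<otimes> c))"

text \<open>The inclusion of \<open>H \<inter> K\<close> in \<open>X\<close> keeps the shortest
  representative inside \<open>X\<close>, which will be \<open>H\<^sub>1\<close> or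
  \<open>K\<close>.\<close>

lemma coset_short_decomp:
  assumes X: "subgroup X G" "H \<inter> K \<subseteq> X" and g: "g \<in> X"
  obtains g' c where "g = g' \<otimes> c" "g' \<in> X" "c \<in> H \<inter> K" "coset_short g'"
proof -
  have G0: "subgroup (H \<inter> K) G" using subgroups_Inter_pair H(1) K(1) by blast
  note gc = subgroup.mem_carrier[OF X(1) g]
  obtain c where c: "c \<in> H \<inter> K" and min: "\<And>c'. c' \<in> H \<inter> K \<Longrightarrow> len (g \<otimes> c) \<le> len (g \<otimes> c')"
    using ex_has_least_nat[of "\<lambda>c. c \<in> H \<inter> K" \<one> "\<lambda>c. len (g \<otimes> c)"] subgroup.one_closed[OF G0]
    by blast
  have cc: "c \<in> carrier G" using c H_carrier by blast
  have "coset_short (g \<otimes> c)" unfolding coset_short_def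
  proof
    fix c' assume c': "c' \<in> H \<inter> K"
    have "(g \<otimes> c) \<otimes> c' = g \<otimes> (c \<otimes> c')" using gc cc c' H_carrier by (simp add: m_assoc)
    then show "len (g \<otimes> c) \<le> len (g \<otimes> c \<otimes> c')"
      using min[OF subgroup.m_closed[OF G0 c c']] by simp
  qed
  moreover have "g = (g \<otimes> c) \<otimes> inv c" using gc cc by (simp add: m_assoc)
  moreover have "g \<otimes> c \<in> X" using subgroup.m_closed[OF X(1) g] c X(2) by blast
  moreover have "inv c \<in> H \<inter> K" using subgroup.m_inv_closed[OF G0 c] .
  ultimately show ?thesis using that by blast
qed

section \<open>Congruences between words of the amalgam\<close>

abbreviation amalg_equiv (infix "\<approx>" 50) where
  "u \<approx> v \<equiv> amalg_eq (G\<lparr>carrier := H\<^sub>1\<rparr>) (G\<lparr>carrier := K\<rparr>) (H \<inter> K) (\<lambda>x. x) (\<lambda>x. x) u v"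

sublocale am: amalgam_setup "G\<lparr>carrier := H\<^sub>1\<rparr>" "G\<lparr>carrier := K\<rparr>" "H \<inter> K" "\<lambda>x. x" "\<lambda>x. x"
proof -
  interpret A: group "G\<lparr>carrier := H\<^sub>1\<rparr>" by (rule subgroup.subgroup_is_group[OF H1(1) is_group])
  interpret B: group "G\<lparr>carrier := K\<rparr>" by (rule subgroup.subgroup_is_group[OF K(1) is_group])
  show "amalgam_setup (G\<lparr>carrier := H\<^sub>1\<rparr>) (G\<lparr>carrier := K\<rparr>) (H \<inter> K) (\<lambda>x. x) (\<lambda>x. x)"
    by unfold_locales (use H1 in auto)
qed

lemma Cons_words:
  "Inl h # w \<in> am.W \<longleftrightarrow> h \<in> H\<^sub>1 \<and> w \<in> am.W"
  "Inr k # w \<in> am.W \<longleftrightarrow> k \<in> K \<and> w \<in> am.W"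
  by (auto simp: amalg_words_def)

lemma append_words: "u @ v \<in> am.W \<longleftrightarrow> u \<in> am.W \<and> v \<in> am.W"
  by (auto simp: amalg_words_def)

lemmas words_simps = Cons_words append_words am.words_Nil

lemma equiv_prefix: "u \<approx> v \<Longrightarrow> p \<in> am.W \<Longrightarrow> p @ u \<approx> p @ v"
  by (intro amalg_eq.append amalg_eq.refl)

lemma equiv_suffix: "u \<approx> v \<Longrightarrow> q \<in> am.W \<Longrightarrow> u @ q \<approx> v @ q"
  by (intro amalg_eq.append amalg_eq.refl)

lemma equiv_Inr: "k \<in> K \<Longrightarrow> k' \<in> K \<Longrightarrow> [Inr k, Inr k'] \<approx> [Inr (k \<otimes> k')]"
  using amalg_eq.mult_right[of k "G\<lparr>carrier := K\<rparr>" k'] by simp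

lemma equiv_Inl: "h \<in> H\<^sub>1 \<Longrightarrow> h' \<in> H\<^sub>1 \<Longrightarrow> [Inl h, Inl h'] \<approx> [Inl (h \<otimes> h')]"
  using amalg_eq.mult_left[of h "G\<lparr>carrier := H\<^sub>1\<rparr>" h'] by simp

lemma equiv_amalg: "c \<in> H \<inter> K \<Longrightarrow> [Inl c] \<approx> [Inr c]"
  using amalg_eq.amalg[of c "H \<inter> K" _ _ "\<lambda>x. x" "\<lambda>x. x"] by simp

lemma equiv_Inr_Inl:
  assumes "k \<in> K" "c \<in> H \<inter> K"
  shows "[Inr k, Inl c] \<approx> [Inr (k \<otimes> c)]"
proof -
  have "[Inr k] @ [Inl c] \<approx> [Inr k] @ [Inr c]"
    using assms by (intro equiv_prefix equiv_amalg) (auto simp: words_simps)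
  then show ?thesis using equiv_Inr[of k c] assms by (auto intro: amalg_eq.trans)
qed

lemma equiv_Inl_Inr:
  assumes "h \<in> H\<^sub>1" "c \<in> H \<inter> K"
  shows "[Inl (h \<otimes> c)] \<approx> [Inl h, Inr c]"
proof -
  have "[Inl (h \<otimes> c)] \<approx> [Inl h, Inl c]"
    using equiv_Inl[of h c] assms G0_subset by (blast intro: amalg_eq.sym)
  moreover have "[Inl h] @ [Inl c] \<approx> [Inl h] @ [Inr c]"
    using assms by (intro equiv_prefix equiv_amalg) (auto simp: words_simps)
  ultimately show ?thesis by (auto intro: amalg_eq.trans)
qed

lemma equiv_shift:
  assumes "k \<in> K" "c \<in> H \<inter> K" "h \<in> H\<^sub>1"
  shows "[Inr (k \<otimes> c), Inl h] \<approx> [Inr k, Inl (c \<otimes> h)]"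
proof -
  have "[Inr (k \<otimes> c)] @ [Inl h] \<approx> [Inr k, Inl c] @ [Inl h]"
    using assms by (intro equiv_suffix amalg_eq.sym[OF equiv_Inr_Inl]) (auto simp: words_simps)
  moreover have "[Inr k] @ [Inl c, Inl h] \<approx> [Inr k] @ [Inl (c \<otimes> h)]"
    using assms G0_subset by (intro equiv_prefix equiv_Inl) (auto simp: words_simps)
  ultimately show ?thesis by (auto intro: amalg_eq.trans)
qed

lemma equiv_merge:
  assumes "h \<in> H\<^sub>1" "c \<in> H \<inter> K" "h' \<in> H\<^sub>1"
  shows "[Inl h, Inr c, Inl h'] \<approx> [Inl (h \<otimes> c \<otimes> h')]"
proof -
  have "[Inl h, Inr c] @ [Inl h'] \<approx> [Inl (h \<otimes> c)] @ [Inl h']"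
    using assms by (intro equiv_suffix amalg_eq.sym[OF equiv_Inl_Inr]) (auto simp: words_simps)
  moreover have "[Inl (h \<otimes> c), Inl h'] \<approx> [Inl (h \<otimes> c \<otimes> h')]"
    using assms G0_subset H1(1) by (intro equiv_Inl subgroup.m_closed) auto
  ultimately show ?thesis by (auto intro: amalg_eq.trans)
qed

text \<open>
  The list \<open>[(k\<^sub>0, h\<^sub>1), (k\<^sub>1, h\<^sub>2), \<dots>]\<close> stands for \<open>k\<^sub>0 h\<^sub>1 k\<^sub>1 h\<^sub>2 \<dots>\<close>; only \<open>k\<^sub>0\<close> may lie in \<open>H\<close>.
\<close>

definition reduced :: "('a \<times> 'a) list \<Rightarrow> bool" where
  "reduced ps \<longleftrightarrow>
     (\<forall>(k, h) \<in> set ps. k \<in> K \<and> coset_short k \<and> h \<in> H\<^sub>1 \<and> h \<notin> K \<and> coset_short h) \<and>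
     (\<forall>(k, h) \<in> set (tl ps). k \<notin> H)"

definition pair_word :: "('a \<times> 'a) list \<Rightarrow> ('a + 'a) list" where
  "pair_word ps = concat (map (\<lambda>(k, h). [Inr k, Inl h]) ps)"

lemma pair_word_snoc: "pair_word (ps @ [(k, h)]) = pair_word ps @ [Inr k, Inl h]"
  by (simp add: pair_word_def)

lemma reduced_snoc:
  "reduced (ps @ [(k, h)]) \<longleftrightarrow> reduced ps \<and> k \<in> K \<and> coset_short k \<and> h \<in> H\<^sub>1 \<and> h \<notin> K \<and>
     coset_short h \<and> (ps \<noteq> [] \<longrightarrow> k \<notin> H)"
  by (cases ps) (auto simp: reduced_def)

lemma reduced_pair_word: "reduced ps \<Longrightarrow> pair_word ps \<in> am.W"
proof (induction ps rule: rev_induct)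
  case (snoc p ps)
  then show ?case by (cases p) (auto simp: reduced_snoc pair_word_snoc words_simps)
qed (simp add: pair_word_def words_simps)

text \<open>Corrections from \<open>H \<inter> K\<close> move right and end in the unrestricted last
  letter. If \<open>k\<close> lies in \<open>H\<close> after an earlier pair, the two
  \<open>H\<^sub>1\<close>-syllables around it fuse; the last pair then either keeps its
  \<open>K\<close>-entry and gets a new \<open>H\<^sub>1\<close>-entry, or disappears when the fused
  element lies in \<open>K\<close>.\<close>

lemma normal_form_push:
  assumes ps: "reduced ps" and k: "k \<in> K" and h: "h \<in> H\<^sub>1"
  shows "\<exists>qs k'. reduced qs \<and> k' \<in> K \<and> pair_word ps @ [Inr k, Inl h] \<approx> pair_word qs @ [Inr k']"
proof (cases "h \<in> K")
  case True
  then have c: "h \<in> H \<inter> K" using h H1(2) by blast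
  then have "pair_word ps @ [Inr k, Inl h] \<approx> pair_word ps @ [Inr (k \<otimes> h)]"
    using k ps by (intro equiv_prefix equiv_Inr_Inl reduced_pair_word)
  moreover have "k \<otimes> h \<in> K" using K(1) k True by (rule subgroup.m_closed)
  ultimately show ?thesis using ps by blast
next
  case hK: False
  have decomp: "\<exists>h' c. x = h' \<otimes> c \<and> h' \<in> H\<^sub>1 \<and> h' \<notin> K \<and> c \<in> H \<inter> K \<and> coset_short h'"
    if x: "x \<in> H\<^sub>1" "x \<notin> K" for x
  proof -
    obtain h' c where h': "x = h' \<otimes> c" "h' \<in> H\<^sub>1" "c \<in> H \<inter> K" "coset_short h'"
      using coset_short_decomp[OF H1(1) _ x(1)] G0_subset by blast
    moreover have "h' \<notin> K" using x(2) h' subgroup.m_closed[OF K(1), of h' c] by blast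
    ultimately show ?thesis by blast
  qed
  show ?thesis
  proof (cases "k \<in> H \<and> ps \<noteq> []")
    case False
    obtain k' c where k': "k = k' \<otimes> c" "k' \<in> K" "c \<in> H \<inter> K" "coset_short k'"
      using coset_short_decomp[OF K(1) _ k] by blast
    have c: "c \<in> H\<^sub>1" using k' G0_subset by blast
    then have x: "c \<otimes> h \<in> H\<^sub>1" using H1(1) h by (simp add: subgroup.m_closed)
    have "c \<otimes> h \<notin> K"
    proof
      assume "c \<otimes> h \<in> K"
      then have "inv c \<otimes> (c \<otimes> h) \<in> K"
        using K(1) k'(3) by (simp add: subgroup.m_closed subgroup.m_inv_closed)
      then show False using hK h c H1_carrier by simp
    qed
    then obtain h' e where h': "c \<otimes> h = h' \<otimes> e" "h' \<in> H\<^sub>1" "h' \<notin> K" "e \<in> H \<inter> K" "coset_short h'"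
      using decomp x by metis
    have "k' \<notin> H" if "ps \<noteq> []"
      using False that k' subgroup.m_closed[OF H(1), of k' c] by blast
    then have red: "reduced (ps @ [(k', h')])" using ps k' h' by (simp add: reduced_snoc)
    have "[Inr k, Inl h] \<approx> [Inr k', Inl (h' \<otimes> e)]"
      using equiv_shift[OF k'(2,3) h] by (simp add: k'(1) h'(1))
    moreover have "[Inr k'] @ [Inl (h' \<otimes> e)] \<approx> [Inr k'] @ [Inl h', Inr e]"
      using k' h' by (intro equiv_prefix equiv_Inl_Inr) (auto simp: words_simps)
    ultimately have "[Inr k, Inl h] \<approx> [Inr k', Inl h', Inr e]" by (auto intro: amalg_eq.trans)
    from equiv_prefix[OF this reduced_pair_word[OF ps]]
    have "pair_word ps @ [Inr k, Inl h] \<approx> pair_word (ps @ [(k', h')]) @ [Inr e]"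
      by (simp add: pair_word_snoc)
    then show ?thesis using red h'(4) by blast
  next
    case True
    then have kc: "k \<in> H \<inter> K" using k by blast
    obtain qs k0 h0 where qs: "ps = qs @ [(k0, h0)]"
      using True by (metis rev_exhaust surj_pair)
    have q: "reduced qs" "k0 \<in> K" "coset_short k0" "h0 \<in> H\<^sub>1" "qs \<noteq> [] \<longrightarrow> k0 \<notin> H"
      using ps by (simp_all add: qs reduced_snoc)
    let ?x = "h0 \<otimes> k \<otimes> h"
    have x: "?x \<in> H\<^sub>1" using H1(1) q(4) h G0_subset[OF kc] by (simp add: subgroup.m_closed)
    have pre: "pair_word qs @ [Inr k0] \<in> am.W"
      using reduced_pair_word[OF q(1)] q(2) by (simp add: words_simps)
    have e1: "pair_word ps @ [Inr k, Inl h] \<approx> pair_word qs @ [Inr k0, Inl ?x]"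
      using equiv_prefix[OF equiv_merge[OF q(4) kc h] pre] by (simp add: qs pair_word_snoc)
    show ?thesis
    proof (cases "?x \<in> K")
      case True
      then have "[Inr k0, Inl ?x] \<approx> [Inr (k0 \<otimes> ?x)]" using x H1(2) q(2) by (intro equiv_Inr_Inl) auto
      from amalg_eq.trans[OF e1 equiv_prefix[OF this reduced_pair_word[OF q(1)]]]
      show ?thesis using q(1) subgroup.m_closed[OF K(1) q(2) True] by blast
    next
      case False
      then obtain h' e where h': "?x = h' \<otimes> e" "h' \<in> H\<^sub>1" "h' \<notin> K" "e \<in> H \<inter> K" "coset_short h'"
        using decomp x by metis
      have "[Inl ?x] \<approx> [Inl h', Inr e]" unfolding h'(1) using h' by (intro equiv_Inl_Inr)
      from equiv_prefix[OF this pre]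
      have "pair_word qs @ [Inr k0, Inl ?x] \<approx> pair_word (qs @ [(k0, h')]) @ [Inr e]"
        by (simp add: pair_word_snoc)
      moreover have "reduced (qs @ [(k0, h')])" using q h' by (simp add: reduced_snoc)
      ultimately show ?thesis using h'(4) amalg_eq.trans[OF e1] by blast
    qed
  qed
qed

lemma normal_form:
  "w \<in> am.W \<Longrightarrow> \<exists>ps k. reduced ps \<and> k \<in> K \<and> w \<approx> pair_word ps @ [Inr k]"
proof (induction w rule: rev_induct)
  case Nil
  have "[] \<approx> pair_word [] @ [Inr \<one>]"
    using amalg_eq.sym[OF amalg_eq.one_right[of _ "G\<lparr>carrier := K\<rparr>"]] by (simp add: pair_word_def)
  moreover have "\<one> \<in> K" using K(1) by (rule subgroup.one_closed)
  moreover have "reduced []" by (simp add: reduced_def)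
  ultimately show ?case by blast
next
  case (snoc s w)
  then have w: "w \<in> am.W" and s: "[s] \<in> am.W" by (auto simp: words_simps)
  obtain ps k where pk: "reduced ps" "k \<in> K" "w \<approx> pair_word ps @ [Inr k]"
    using snoc.IH[OF w] by blast
  have e: "w @ [s] \<approx> pair_word ps @ [Inr k, s]" using equiv_suffix[OF pk(3) s] by simp
  show ?case
  proof (cases s)
    case (Inl h)
    then have "h \<in> H\<^sub>1" using s by (simp add: words_simps)
    then show ?thesis using normal_form_push[OF pk(1,2)] amalg_eq.trans[OF e] Inl by metis
  next
    case (Inr k')
    then have k': "k' \<in> K" using s by (simp add: words_simps)
    have "pair_word ps @ [Inr k, s] \<approx> pair_word ps @ [Inr (k \<otimes> k')]"
      unfolding Inr using pk k' by (intro equiv_prefix equiv_Inr reduced_pair_word)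
    moreover have "k \<otimes> k' \<in> K" using K(1) pk(2) k' by (rule subgroup.m_closed)
    ultimately show ?thesis using pk(1) amalg_eq.trans[OF e] by blast
  qed
qed

section \<open>The chain of a normal form\<close>

lemma len_syllable: "h \<in> H\<^sub>1 \<Longrightarrow> h \<notin> K \<Longrightarrow> syllable_bound \<mu> \<le> real (len h)"
  using long_syllables by force

text \<open>Only the syllable before the corner has to be shortest in its coset, so this also covers
  the arbitrary last syllable.\<close>

lemma corner_HK: "h \<in> H\<^sub>1 \<Longrightarrow> coset_short h \<Longrightarrow> k \<in> K \<Longrightarrow> gp \<one> (inv h) k < overlap_bound \<mu> \<mu>"
  using H1(2) by (intro corner_coset[OF H(1,2) K \<mu>_nonneg]) (auto simp: coset_short_def)

lemma corner_KH: "k \<in> K \<Longrightarrow> coset_short k \<Longrightarrow> h \<in> H\<^sub>1 \<Longrightarrow> gp \<one> (inv k) h < overlap_bound \<mu> \<mu>"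
  using H1(2) by (intro corner_coset[OF K H(1,2) \<mu>_nonneg]) (auto simp: coset_short_def)

text \<open>If \<open>k\<close> is short, the two geodesics follow \<open>H\<close> and k
  \<open>H\<close>, and malnormality applies. If \<open>k\<close> is long, the small corner at
  \<open>k\<close> makes (k | k h')_1 exceed \<open>overlap_bound \<mu> \<mu> + \<Delta>\<close>, so
  \<open>k \<otimes> h'\<close> leaves 1 in the direction of \<open>k\<close>, and the corner
  between \<open>h\<close> and \<open>k\<close> decides.\<close>

lemma corner_H_side:
  assumes h: "h \<in> H\<^sub>1" "coset_short h" and k: "k \<in> K" "coset_short k" "k \<notin> H" and h': "h' \<in> H\<^sub>1"
  shows "gp \<one> (inv h) (k \<otimes> h') \<le> corner_bound \<mu> - \<Delta>"
proof (cases "real (len k) \<le> 2 * overlap_bound \<mu> \<mu> + \<Delta>")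
  case True
  have "gp \<one> (inv h) (k \<otimes> h') < overlap_bound \<mu> (\<delta> + (2 * overlap_bound \<mu> \<mu> + \<Delta>) + \<mu>)"
    using h h' H1(2) k K_carrier True subgroup.m_inv_closed[OF H(1), of h]
    by (intro corner_malnormal[OF H \<mu>_nonneg]) auto
  then show ?thesis using \<Delta>_ge by (simp add: corner_bound_def max_def)
next
  case False
  have c: "inv h \<in> carrier G" "k \<in> carrier G" "k \<otimes> h' \<in> carrier G" "inv k \<in> carrier G"
    "h' \<in> carrier G"
    using h k h' H1_carrier K_carrier by auto
  have "gp k \<one> (k \<otimes> h') = gp \<one> (inv k) h'"
    using gp_left_mult[of "inv k" k \<one> "k \<otimes> h'"] c by simp
  then have "gp k \<one> (k \<otimes> h') < overlap_bound \<mu> \<mu>" using corner_KH[OF k(1,2) h'] by simp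
  then have "gp \<one> k (k \<otimes> h') > overlap_bound \<mu> \<mu> + \<Delta>"
    using gp_compl[of \<one> k "k \<otimes> h'"] c d_one[of k] False by simp
  moreover have "gp \<one> (inv h) k < overlap_bound \<mu> \<mu>" by (rule corner_HK[OF h k(1)])
  moreover have "gp \<one> (inv h) (k \<otimes> h') \<le> gp \<one> (inv h) k + \<Delta> \<or>
      gp \<one> (k \<otimes> h') k \<le> gp \<one> (inv h) k + \<Delta>"
    using gromov[OF one_closed c(1,3,2)] .
  moreover have "gp \<one> (k \<otimes> h') k = gp \<one> k (k \<otimes> h')" using gp_sym c by blast
  ultimately have "gp \<one> (inv h) (k \<otimes> h') \<le> overlap_bound \<mu> \<mu> + \<Delta>" by argo
  then show ?thesis by (simp add: corner_bound_def max_def)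
qed

text \<open>A geodesic to the inverse of \<open>k \<otimes> h\<close> follows \<open>inv h\<close>
  for almost all of |h|, because the corner between \<open>k\<close> and \<open>h\<close> is small.
  Replacing \<open>inv h\<close> by that inverse therefore costs one \<Delta>.\<close>

lemma corner_side:
  assumes k: "k \<in> K" "coset_short k" and h: "h \<in> H\<^sub>1" "h \<notin> K" and y: "y \<in> carrier G"
    and gp: "gp \<one> (inv h) y \<le> corner_bound \<mu> - \<Delta>"
  shows "gp \<one> (inv (k \<otimes> h)) y \<le> corner_bound \<mu>"
proof -
  have c: "h \<in> carrier G" "k \<in> carrier G" using h k H1_carrier K_carrier by auto
  have inv: "inv (k \<otimes> h) = inv h \<otimes> inv k" using c by (simp add: inv_mult_group)
  have "gp (inv h) \<one> (inv h \<otimes> inv k) = gp \<one> h (inv k)"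
    using gp_left_mult[of h "inv h" \<one> "inv h \<otimes> inv k"] c by simp
  moreover have "gp \<one> h (inv k) < overlap_bound \<mu> \<mu>"
    using corner_KH[OF k h(1)] gp_sym[of h "inv k" \<one>] c by simp
  ultimately have "gp \<one> (inv h) (inv h \<otimes> inv k) > syllable_bound \<mu> - overlap_bound \<mu> \<mu>"
    using gp_compl[of \<one> "inv h" "inv h \<otimes> inv k"] c d_one[of "inv h"] len_inv[of h] len_syllable[OF h]
    by simp
  moreover have "gp \<one> (inv h) (inv h \<otimes> inv k) \<le> gp \<one> (inv h) y + \<Delta> \<or>
      gp \<one> (inv h \<otimes> inv k) y \<le> gp \<one> (inv h) y + \<Delta>"
    by (rule gromov) (use c y in auto)
  ultimately show ?thesis unfolding inv using gp \<Delta>_ge(1) corner_bound_nonneg[of \<mu>]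
      overlap_bound_nonneg[of \<mu> \<mu>] by (auto simp: syllable_bound_def)
qed

lemma len_side:
  assumes k: "k \<in> K" "coset_short k" and h: "h \<in> H\<^sub>1" "h \<notin> K"
  shows "d \<one> (k \<otimes> h) > 2 * corner_bound \<mu> + 3 * \<Delta>"
proof -
  have c: "h \<in> carrier G" "k \<in> carrier G" using h k H1_carrier K_carrier by auto
  have "d (inv k) h = d \<one> (k \<otimes> h)" using d_left_mult[of k "inv k" h] c by simp
  then have "d \<one> (k \<otimes> h) = d \<one> (inv k) + d \<one> h - 2 * gp \<one> (inv k) h" by (simp add: gp_def field_simps)
  then show ?thesis
    using corner_KH[OF k h(1)] len_syllable[OF h] d_one[OF c(1)] d_nonneg[of \<one> "inv k"] \<Delta>_ge(1)
    by (simp add: syllable_bound_def)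
qed

text \<open>The final \<open>k\<close> forms a side of its own, possibly short or trivial; the chain
  lemmas allow this for a last side.\<close>

definition sides :: "('a \<times> 'a) list \<Rightarrow> 'a \<Rightarrow> 'a list" where
  "sides ps k = map (\<lambda>(k, h). k \<otimes> h) ps @ [k]"

lemma length_sides: "length (sides ps k) = length ps + 1"
  by (simp add: sides_def)

lemma reduced_nth:
  assumes "reduced ps" "i < length ps"
  obtains k h where "ps ! i = (k, h)" "k \<in> K" "coset_short k" "h \<in> H\<^sub>1" "h \<notin> K" "coset_short h"
    "i > 0 \<Longrightarrow> k \<notin> H"
proof -
  obtain k h where kh: "ps ! i = (k, h)" by fastforce
  then have "(k, h) \<in> set ps" using assms(2) nth_mem by fastforce
  then have "k \<in> K \<and> coset_short k \<and> h \<in> H\<^sub>1 \<and> h \<notin> K \<and> coset_short h"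
    using assms(1) unfolding reduced_def by blast
  moreover have "k \<notin> H" if "i > 0"
  proof -
    have "tl ps ! (i - 1) = (k, h)" using kh that assms(2) by (simp add: nth_tl)
    then have "(k, h) \<in> set (tl ps)" using that assms(2) nth_mem[of "i - 1" "tl ps"] by force
    then show ?thesis using assms(1) unfolding reduced_def by blast
  qed
  ultimately show ?thesis using kh that by blast
qed

lemma sides_nth:
  "i < length ps \<Longrightarrow> ps ! i = (k', h) \<Longrightarrow> sides ps k ! i = k' \<otimes> h"
  "sides ps k ! length ps = k"
  by (simp_all add: sides_def nth_append)

lemma sides_carrier:
  assumes "reduced ps" "k \<in> K"
  shows "set (sides ps k) \<subseteq> carrier G"
  using assms K_carrier H1_carrier by (auto simp: sides_def reduced_def)

lemma sides_corner:
  assumes ps: "reduced ps" and k: "k \<in> K" and i: "i < length ps"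
  shows "gp \<one> (inv (sides ps k ! i)) (sides ps k ! (i + 1)) \<le> corner_bound \<mu>"
proof -
  obtain k' h where kh: "ps ! i = (k', h)" "k' \<in> K" "coset_short k'" "h \<in> H\<^sub>1" "h \<notin> K" "coset_short h"
    using reduced_nth[OF ps i] by metis
  have "gp \<one> (inv h) (sides ps k ! (i + 1)) \<le> corner_bound \<mu> - \<Delta>"
  proof (cases "i + 1 < length ps")
    case True
    obtain k'' h'' where "ps ! (i + 1) = (k'', h'')" "k'' \<in> K" "coset_short k''" "h'' \<in> H\<^sub>1" "k'' \<notin> H"
      using reduced_nth[OF ps True] by (metis add_gr_0 zero_less_one)
    then show ?thesis using corner_H_side kh sides_nth(1)[OF True] by simp
  next
    case False
    \<comment> \<open>The next side is the bare last syllable, about which only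
      \<open>k \<in> K\<close> is known.\<close>
    then have "i + 1 = length ps" using i by simp
    then have "sides ps k ! (i + 1) = k" using sides_nth(2) by simp
    then show ?thesis using corner_HK[OF kh(4,6) k] \<Delta>_ge(1) by (simp add: corner_bound_def max_def)
  qed
  moreover have "sides ps k ! (i + 1) \<in> set (sides ps k)" using i by (intro nth_mem) (simp add: length_sides)
  then have "sides ps k ! (i + 1) \<in> carrier G" using sides_carrier[OF ps k] by blast
  ultimately show ?thesis using corner_side kh sides_nth(1)[OF i kh(1)] by simp
qed

definition chain :: "('a \<times> 'a) list \<Rightarrow> 'a \<Rightarrow> nat \<Rightarrow> 'a" where
  "chain ps k i = eval_word (take i (sides ps k))"

lemma chain_0: "chain ps k 0 = \<one>"
  by (simp add: chain_def)

context
  fixes ps k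
  assumes ps: "reduced ps" and k: "k \<in> K"
begin

lemma chain_carrier: "chain ps k i \<in> carrier G"
  unfolding chain_def using sides_carrier[OF ps k] set_take_subset
  by (intro eval_word_closed) fast

lemma side_carrier: "i \<le> length ps \<Longrightarrow> sides ps k ! i \<in> carrier G"
  using sides_carrier[OF ps k] nth_mem[of i "sides ps k"] by (auto simp: length_sides)

lemma chain_Suc:
  assumes i: "i \<le> length ps"
  shows "chain ps k (i + 1) = chain ps k i \<otimes> sides ps k ! i"
proof -
  have "take (i + 1) (sides ps k) = take i (sides ps k) @ [sides ps k ! i]"
    using i by (simp add: take_Suc_conv_app_nth length_sides)
  moreover have "set (take i (sides ps k)) \<subseteq> carrier G"
    using sides_carrier[OF ps k] set_take_subset by fast
  ultimately show ?thesis
    using side_carrier[OF i] eval_word_append[of "take i (sides ps k)" "[sides ps k ! i]"]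
    by (simp add: chain_def del: foldr_append)
qed

lemma chain_corner:
  assumes "i + 2 \<le> length ps + 1"
  shows "gp (chain ps k (i + 1)) (chain ps k i) (chain ps k (i + 2)) \<le> corner_bound \<mu>"
proof -
  let ?z = "chain ps k" and ?t = "sides ps k"
  have c: "?z i \<in> carrier G" "?z (i + 1) \<in> carrier G" "?t ! i \<in> carrier G" "?t ! (i + 1) \<in> carrier G"
    using chain_carrier side_carrier assms by auto
  have 1: "?z (i + 1) = ?z i \<otimes> ?t ! i" using chain_Suc[of i] assms by simp
  have "?z i = ?z (i + 1) \<otimes> inv (?t ! i)" unfolding 1 using c by (simp add: m_assoc)
  moreover have "?z (i + 2) = ?z (i + 1) \<otimes> ?t ! (i + 1)" using chain_Suc[of "i + 1"] assms by simp
  moreover have "?z (i + 1) = ?z (i + 1) \<otimes> \<one>" using c by simp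
  ultimately have "gp (?z (i + 1)) (?z i) (?z (i + 2)) = gp \<one> (inv (?t ! i)) (?t ! (i + 1))"
    using gp_left_mult[of "?z (i + 1)" \<one> "inv (?t ! i)" "?t ! (i + 1)"] c by simp
  then show ?thesis using sides_corner[OF ps k, of i] assms by simp
qed

lemma chain_dist: "i \<le> length ps \<Longrightarrow> d (chain ps k i) (chain ps k (i + 1)) = d \<one> (sides ps k ! i)"
  using chain_Suc[of i] d_left_mult[of "chain ps k i" \<one> "sides ps k ! i"] chain_carrier side_carrier
  by simp

lemma chain_long:
  assumes "i < length ps"
  shows "d (chain ps k i) (chain ps k (i + 1)) > 2 * corner_bound \<mu> + 3 * \<Delta>"
proof -
  obtain k' h where kh: "ps ! i = (k', h)" "k' \<in> K" "coset_short k'" "h \<in> H\<^sub>1" "h \<notin> K"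
    using reduced_nth[OF ps assms] by metis
  then show ?thesis using chain_dist[of i] assms sides_nth(1)[OF assms kh(1)] len_side by simp
qed

lemma chain_long': "i + 3 \<le> length ps + 1 \<Longrightarrow>
    d (chain ps k (i + 1)) (chain ps k (i + 2)) > 2 * corner_bound \<mu> + 3 * \<Delta>"
  using chain_long[of "i + 1"] by simp

text \<open>A corner costs at most \<open>2 * corner_bound \<mu> + 2 * \<Delta>\<close>, less than
  the length of each side added here, so the distance from the start keeps growing.\<close>

lemma chain_away:
  "i < length ps \<Longrightarrow> d (chain ps k 0) (chain ps k (i + 1)) > 2 * corner_bound \<mu> + 3 * \<Delta>"
proof (induction i)
  case 0
  then show ?case using chain_long[of 0] by simp
next
  case (Suc i)
  have "d (chain ps k 0) (chain ps k (i + 2)) \<ge> d (chain ps k 0) (chain ps k (i + 1)) +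
      d (chain ps k (i + 1)) (chain ps k (i + 2)) - 2 * corner_bound \<mu> - 2 * \<Delta>"
    using Suc.prems
    by (intro chain_growth[where n = "length ps + 1", OF chain_carrier chain_corner chain_long']) auto
  then show ?case using Suc chain_long[of "i + 1"] \<Delta>_ge(1) by simp
qed

text \<open>Even if the last side is trivial, the loss at the last corner is smaller than the
  distance already reached by \<open>chain_away\<close>.\<close>

lemma chain_end_neq_one:
  assumes "ps \<noteq> []"
  shows "chain ps k (length ps + 1) \<noteq> \<one>"
proof
  assume one: "chain ps k (length ps + 1) = \<one>"
  obtain i where i: "length ps = i + 1" using assms by (cases ps) auto
  have "d (chain ps k 0) (chain ps k (i + 2)) \<ge> d (chain ps k 0) (chain ps k (i + 1)) +
      d (chain ps k (i + 1)) (chain ps k (i + 2)) - 2 * corner_bound \<mu> - 2 * \<Delta>"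
    using i
    by (intro chain_growth[where n = "length ps + 1", OF chain_carrier chain_corner chain_long']) auto
  moreover have "d (chain ps k 0) (chain ps k (i + 2)) = 0"
    using one i d_refl[OF one_closed] by (simp add: chain_0)
  ultimately show False
    using chain_away[of i] i d_nonneg[of "chain ps k (i + 1)" "chain ps k (i + 2)"] \<Delta>_ge(1) by simp
qed

end

lemma word_value_pair_word:
  assumes "reduced ps" "k \<in> K"
  shows "word_value G (\<lambda>x. x) (\<lambda>x. x) (pair_word ps @ [Inr k]) = chain ps k (length ps + 1)"
proof -
  have "\<forall>(k, h) \<in> set ps. k \<in> carrier G \<and> h \<in> carrier G"
    using assms K_carrier H1_carrier by (auto simp: reduced_def)
  then have "word_value G (\<lambda>x. x) (\<lambda>x. x) (pair_word ps @ [Inr k]) = eval_word (sides ps k)"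
  proof (induction ps)
    case Nil
    then show ?case by (simp add: word_value_def pair_word_def sides_def)
  next
    case (Cons p ps)
    obtain k' h where p: "p = (k', h)" by fastforce
    have "eval_word (sides ps k) \<in> carrier G"
      using Cons.prems assms(2) K_carrier by (intro eval_word_closed) (auto simp: sides_def)
    then show ?case using Cons p
      by (simp add: word_value_def pair_word_def sides_def m_assoc)
  qed
  then show ?thesis by (simp add: chain_def length_sides)
qed

section \<open>The subgroup generated by both factors\<close>

abbreviation M :: "'a set" where
  "M \<equiv> generate G (H\<^sub>1 \<union> K)"

lemma factors_carrier: "H\<^sub>1 \<union> K \<subseteq> carrier G"
  using H1_carrier K_carrier by blast

lemma subgroup_M: "subgroup M G"
  by (rule generate_is_subgroup[OF factors_carrier])

section \<open>The natural homomorphism from the amalgam onto \<open>M\<close>\<close>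

lemma inclusion_homs:
  "(\<lambda>x. x) \<in> hom (G\<lparr>carrier := H\<^sub>1\<rparr>) G" "(\<lambda>x. x) \<in> hom (G\<lparr>carrier := K\<rparr>) G"
  using H1_carrier K_carrier by (auto simp: hom_def)

abbreviation val :: "('a + 'a) list \<Rightarrow> 'a" where
  "val \<equiv> word_value G (\<lambda>x. x) (\<lambda>x. x)"

lemmas val_append = am.word_value_append[OF is_group inclusion_homs HOL.refl]
lemmas val_cong = am.word_value_cong[OF is_group inclusion_homs HOL.refl]
lemmas map_class = am.amalgam_map_class[OF is_group inclusion_homs HOL.refl]
lemmas map_hom = am.amalgam_map_hom[OF is_group inclusion_homs HOL.refl]

lemma val_in_M: "w \<in> am.W \<Longrightarrow> val w \<in> M"
proof (induction w)
  case Nil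
  then show ?case by (simp add: word_value_def generate.one)
next
  case (Cons s w)
  have "case_sum (\<lambda>x. x) (\<lambda>x. x) s \<in> M"
    using Cons.prems by (cases s) (auto simp: words_simps intro: generate.incl)
  then show ?case using Cons subgroup.m_closed[OF subgroup_M]
    by (cases s) (auto simp: words_simps word_value_def)
qed

lemma val_surj:
  assumes "g \<in> M"
  shows "\<exists>w \<in> am.W. val w = g"
  using assms
proof induction
  case one
  then show ?case using am.words_Nil by (intro bexI[of _ "[]"]) (auto simp: word_value_def)
next
  case (incl h)
  then show ?case
  proof
    assume "h \<in> H\<^sub>1"
    then show ?thesis using H1_carrier
      by (intro bexI[of _ "[Inl h]"]) (auto simp: word_value_def words_simps)
  next
    assume "h \<in> K"
    then show ?thesis using K_carrier
      by (intro bexI[of _ "[Inr h]"]) (auto simp: word_value_def words_simps)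
  qed
next
  case (inv h)
  then show ?case
  proof
    assume "h \<in> H\<^sub>1"
    then show ?thesis using H1_carrier subgroup.m_inv_closed[OF H1(1)]
      by (intro bexI[of _ "[Inl (inv h)]"]) (auto simp: word_value_def words_simps)
  next
    assume "h \<in> K"
    then show ?thesis using K_carrier subgroup.m_inv_closed[OF K(1)]
      by (intro bexI[of _ "[Inr (inv h)]"]) (auto simp: word_value_def words_simps)
  qed
next
  case (eng g h)
  then obtain u v where "u \<in> am.W" "val u = g" "v \<in> am.W" "val v = h" by blast
  then show ?case using val_append[of u v] by (intro bexI[of _ "u @ v"]) (auto simp: words_simps)
qed

text \<open>\<open>chain_end_neq_one\<close> leaves a normal form of value 1 without pairs, that is,
  a single letter of \<open>K\<close>, which must be 1.\<close>

lemma val_eq_one: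
  assumes "w \<in> am.W" "val w = \<one>"
  shows "w \<approx> []"
proof -
  obtain ps k where pk: "reduced ps" "k \<in> K" "w \<approx> pair_word ps @ [Inr k]"
    using normal_form[OF assms(1)] by blast
  have one: "chain ps k (length ps + 1) = \<one>"
    using val_cong[OF pk(3)] assms(2) word_value_pair_word[OF pk(1,2)] by simp
  then have "ps = []" using chain_end_neq_one[OF pk(1,2)] by blast
  then have "k = \<one>" using one K_carrier[OF pk(2)] by (simp add: chain_def sides_def)
  then have "w \<approx> [Inr \<one>]" using pk(3) \<open>ps = []\<close> by (simp add: pair_word_def)
  moreover have "[Inr \<one>] \<approx> []"
    using amalg_eq.one_right[of "G\<lparr>carrier := H\<^sub>1\<rparr>" "G\<lparr>carrier := K\<rparr>"] by simp
  ultimately show ?thesis by (rule amalg_eq.trans)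
qed

lemma amalgam: "is_amalgam_of G H\<^sub>1 K (H \<inter> K)"
proof -
  let ?f = "amalgam_map G (\<lambda>x. x) (\<lambda>x. x)"
  interpret f: group_hom am.P G ?f
    using am.group_amalgam is_group map_hom by (simp add: group_hom_def group_hom_axioms_def)
  have "inj_on ?f (carrier am.P)"
  proof (rule f.inj_on_one_iff[THEN iffD2], intro allI impI)
    fix x assume "x \<in> carrier am.P" "?f x = \<one>"
    then obtain w where w: "w \<in> am.W" "x = am.R `` {w}" "val w = \<one>"
      using map_class by (auto simp: am.carrier_P)
    then have "am.R `` {w} = am.R `` {[]}"
      using val_eq_one by (intro equiv_class_eq[OF am.equiv_R]) (simp add: amalg_rel_def)
    then show "x = \<one>\<^bsub>am.P\<^esub>" using w by (simp add: am.one_P)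
  qed
  moreover have "?f ` carrier am.P = M"
  proof -
    have "?f ` ((\<lambda>w. am.R `` {w}) ` am.W) = val ` am.W"
      unfolding image_image by (rule image_cong[OF HOL.refl]) (rule map_class)
    also have "\<dots> = M"
    proof
      show "val ` am.W \<subseteq> M" by (rule image_subsetI) (rule val_in_M)
      show "M \<subseteq> val ` am.W"
      proof
        fix g assume "g \<in> M"
        then obtain w where "w \<in> am.W" "val w = g" using val_surj by blast
        then show "g \<in> val ` am.W" by blast
      qed
    qed
    finally show ?thesis by (simp only: am.carrier_P)
  qed
  ultimately have "bij_betw ?f (carrier am.P) M" by (simp add: bij_betw_def)
  then show ?thesis using map_hom
    by (auto simp: is_amalgam_of_def iso_def hom_def bij_betw_def)
qed

section \<open>Geodesics between elements of \<open>M\<close>\<close>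

lemma chain_in_M:
  assumes "reduced ps" "k \<in> K" "i \<le> length ps + 1"
  shows "chain ps k i \<in> M"
proof -
  have "set (take i (sides ps k)) \<subseteq> M"
  proof -
    have "k' \<otimes> h \<in> M" if "(k', h) \<in> set ps" for k' h
      using that assms(1) by (intro generate.eng generate.incl) (auto simp: reduced_def)
    then have "set (sides ps k) \<subseteq> M"
      using assms(2) by (auto simp: sides_def intro: generate.incl)
    then show ?thesis using set_take_subset by fast
  qed
  moreover have "eval_word w \<in> M" if "set w \<subseteq> M" for w
    using that by (induction w) (auto intro: generate.one generate.eng)
  ultimately have "eval_word (take i (sides ps k)) \<in> M" by blast
  then show ?thesis by (simp add: chain_def)
qed

text \<open>In the triangle 1, k, k h one side has its ends in \<open>K\<close> and another is a
  translate of a geodesic with ends in \<open>H\<^sub>1\<close>. Here the quasiconvexity of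
  \<open>H\<^sub>1\<close> enters, with its own constant \<nu>.\<close>

lemma side_near_M:
  assumes qc: "quasiconvex_with G S \<nu> H\<^sub>1" and \<nu>: "\<nu> \<ge> 0" and k: "k \<in> K" and h: "h \<in> H\<^sub>1"
    and q: "btw \<one> q (k \<otimes> h)"
  shows "\<exists>s\<in>M. d q s \<le> \<delta> + \<mu> + \<nu>"
proof -
  have c: "k \<in> carrier G" "h \<in> carrier G" "k \<otimes> h \<in> carrier G" "q \<in> carrier G"
    using k h q K_carrier H1_carrier by (auto simp: btw_def)
  have sK: "K \<subseteq> carrier G" and sH1: "H\<^sub>1 \<subseteq> carrier G" using factors_carrier by auto
  obtain y where y: "btw \<one> y k \<or> btw (k \<otimes> h) y k" "d q y \<le> \<delta>"
    using thin[OF one_closed c(3,1) q] by blast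
  have yc: "y \<in> carrier G" using y by (auto simp: btw_def)
  have "\<exists>s\<in>M. d y s \<le> \<mu> + \<nu>"
    using y(1)
  proof
    assume "btw \<one> y k"
    then obtain s where "s \<in> K" "d y s \<le> \<mu>"
      using K(2)[unfolded quasiconvex_with_iff[OF sK], rule_format] subgroup.one_closed[OF K(1)] k
      by blast
    then show ?thesis using \<nu> by (intro bexI[of _ s]) (auto intro: generate.incl)
  next
    assume "btw (k \<otimes> h) y k"
    then have "btw (inv k \<otimes> (k \<otimes> h)) (inv k \<otimes> y) (inv k \<otimes> k)"
      using c by (intro btw_left_mult) auto
    then have "btw h (inv k \<otimes> y) \<one>" using c by simp
    then obtain s where s: "s \<in> H\<^sub>1" "d (inv k \<otimes> y) s \<le> \<nu>"
      using qc[unfolded quasiconvex_with_iff[OF sH1], rule_format] subgroup.one_closed[OF H1(1)] h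
      by blast
    have "d (k \<otimes> (inv k \<otimes> y)) (k \<otimes> s) = d (inv k \<otimes> y) s"
      using c yc s H1_carrier by (intro d_left_mult) auto
    then have "d y (k \<otimes> s) \<le> \<mu> + \<nu>" using c yc s \<mu>_nonneg by simp
    moreover have "k \<otimes> s \<in> M" using k s by (intro generate.eng generate.incl) auto
    ultimately show ?thesis by blast
  qed
  then obtain s where s: "s \<in> M" "d y s \<le> \<mu> + \<nu>" by blast
  have "d q s \<le> d q y + d y s"
    using d_triangle[of q y s] c yc subgroup.mem_carrier[OF subgroup_M s(1)] by blast
  then show ?thesis using s y by (intro bexI[of _ s]) auto
qed

lemma quasiconvex_M:
  assumes "quasiconvex G S H\<^sub>1"
  shows "quasiconvex G S M"
proof -
  obtain \<nu> where \<nu>: "\<nu> \<ge> 0" "quasiconvex_with G S \<nu> H\<^sub>1" using assms by (auto simp: quasiconvex_def)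
  \<comment> \<open>\<open>chain_near\<close> brings a point to a side of the chain, and
    \<open>side_near_M\<close> brings it from there to \<open>M\<close>.\<close>
  let ?C = "2 * corner_bound \<mu> + 5 * \<Delta> + (\<delta> + \<mu> + \<nu>)"
  note sM = subgroup.subset[OF subgroup_M] and memM = subgroup.mem_carrier[OF subgroup_M]
  have "quasiconvex_with G S ?C M"
    unfolding quasiconvex_with_iff[OF sM]
  proof (intro ballI allI impI)
    fix a b p assume ab: "a \<in> M" "b \<in> M" and p: "btw a p b"
    have c: "a \<in> carrier G" "b \<in> carrier G" "p \<in> carrier G" using ab p memM by (auto simp: btw_def)
    have "inv a \<otimes> b \<in> M"
      using ab subgroup_M by (simp add: subgroup.m_closed subgroup.m_inv_closed)
    then obtain w where w: "w \<in> am.W" "val w = inv a \<otimes> b" using val_surj by blast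
    obtain ps k where pk: "reduced ps" "k \<in> K" "w \<approx> pair_word ps @ [Inr k]"
      using normal_form[OF w(1)] by blast
    let ?z = "chain ps k" and ?n = "length ps + 1"
    have zn: "?z ?n = inv a \<otimes> b"
      using val_cong[OF pk(3)] w(2) word_value_pair_word[OF pk(1,2)] by simp
    have "btw (inv a \<otimes> a) (inv a \<otimes> p) (inv a \<otimes> b)" using c p by (intro btw_left_mult) auto
    then have "btw (?z 0) (inv a \<otimes> p) (?z ?n)" using zn c by (simp add: chain_0)
    then have "\<exists>i<?n. \<exists>q. btw (?z i) q (?z (i + 1)) \<and>
        d (inv a \<otimes> p) q \<le> 2 * corner_bound \<mu> + 5 * \<Delta>"
      using chain_carrier[OF pk(1,2)] chain_corner[OF pk(1,2)] chain_long'[OF pk(1,2)]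
        corner_bound_nonneg by (intro chain_near) auto
    then obtain i q where i: "i < ?n" and q: "btw (?z i) q (?z (i + 1))"
      and pq: "d (inv a \<otimes> p) q \<le> 2 * corner_bound \<mu> + 5 * \<Delta>"
      by blast
    have zc: "?z i \<in> carrier G" and qc: "q \<in> carrier G" and tc: "sides ps k ! i \<in> carrier G"
      using chain_carrier[OF pk(1,2)] side_carrier[OF pk(1,2)] q i by (auto simp: btw_def)
    have zS: "?z (i + 1) = ?z i \<otimes> sides ps k ! i" using chain_Suc[OF pk(1,2)] i by simp
    have "btw (inv (?z i) \<otimes> ?z i) (inv (?z i) \<otimes> q) (inv (?z i) \<otimes> (?z i \<otimes> sides ps k ! i))"
      using q zc tc unfolding zS by (intro btw_left_mult) auto
    then have q': "btw \<one> (inv (?z i) \<otimes> q) (sides ps k ! i)" using zc tc by simp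
    have "\<exists>k' h. k' \<in> K \<and> h \<in> H\<^sub>1 \<and> sides ps k ! i = k' \<otimes> h"
    proof (cases "i < length ps")
      case True
      then show ?thesis using reduced_nth[OF pk(1) True] sides_nth(1)[OF True] by metis
    next
      case False
      then have "i = length ps" using i by simp
      \<comment> \<open>Writing the last side with a trivial \<open>H\<^sub>1\<close>-factor lets
        \<open>side_near_M\<close> treat all sides alike.\<close>
      then have "sides ps k ! i = k \<otimes> \<one>" using sides_nth(2) K_carrier[OF pk(2)] by simp
      then show ?thesis using pk(2) subgroup.one_closed[OF H1(1)] by blast
    qed
    then obtain s where s: "s \<in> M" "d (inv (?z i) \<otimes> q) s \<le> \<delta> + \<mu> + \<nu>"
      using side_near_M[OF \<nu>(2,1)] q' by metis
    have sc: "s \<in> carrier G" using s memM by blast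
    have "d (?z i \<otimes> (inv (?z i) \<otimes> q)) (?z i \<otimes> s) = d (inv (?z i) \<otimes> q) s"
      using zc qc sc by (intro d_left_mult) auto
    then have "d q (?z i \<otimes> s) \<le> \<delta> + \<mu> + \<nu>" using s zc qc by simp
    moreover have "d (inv a \<otimes> p) (?z i \<otimes> s) \<le> d (inv a \<otimes> p) q + d q (?z i \<otimes> s)"
      using d_triangle c qc zc sc by simp
    moreover have "d (a \<otimes> (inv a \<otimes> p)) (a \<otimes> (?z i \<otimes> s)) = d (inv a \<otimes> p) (?z i \<otimes> s)"
      using c zc sc by (intro d_left_mult) auto
    ultimately have "d p (a \<otimes> (?z i \<otimes> s)) \<le> ?C" using pq c by simp
    moreover have "a \<otimes> (?z i \<otimes> s) \<in> M"
      using ab s chain_in_M[OF pk(1,2)] i by (intro generate.eng) auto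
    ultimately show "\<exists>s\<in>M. d p s \<le> ?C" by blast
  qed
  moreover have "?C \<ge> 0" using corner_bound_nonneg[of \<mu>] \<Delta>_ge(1) \<delta>_nonneg \<mu>_nonneg \<nu>(1) by simp
  ultimately show ?thesis unfolding quasiconvex_def by blast
qed

end

theorem theorem2:
  fixes G :: "('a, 'm) monoid_scheme" and S :: "'a set" and \<delta> \<mu> :: real
  assumes "group G"
    and "finite S" and "S \<subseteq> carrier G" and "generate G S = carrier G"
    and "\<delta> \<ge> 0" and "negatively_curved G S \<delta>"
    and "\<mu> \<ge> 0"
  shows "\<exists>C\<^sub>1 :: real. \<forall>H K H\<^sub>1.
     subgroup H G \<and> quasiconvex_with G S \<mu> H \<and> malnormal G H \<and>
     subgroup K G \<and> quasiconvex_with G S \<mu> K \<and>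
     subgroup H\<^sub>1 G \<and> H\<^sub>1 \<subseteq> H \<and> H\<^sub>1 \<inter> K = H \<inter> K \<and>
     (\<forall>h \<in> H\<^sub>1. real (word_length G S h) < C\<^sub>1 \<longrightarrow> h \<in> H \<inter> K) \<longrightarrow>
       is_amalgam_of G H\<^sub>1 K (H \<inter> K) \<and>
       (quasiconvex G S H\<^sub>1 \<longrightarrow> quasiconvex G S (generate G (H\<^sub>1 \<union> K)))"
proof -
  interpret group G by fact
  interpret hyperbolic_group G S \<delta> using assms by unfold_locales
  show ?thesis
  proof (intro exI[of _ "syllable_bound \<mu>"] allI impI, elim conjE)
    fix H K H\<^sub>1
    assume "subgroup H G" "quasiconvex_with G S \<mu> H" "malnormal G H"
      "subgroup K G" "quasiconvex_with G S \<mu> K"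
      "subgroup H\<^sub>1 G" "H\<^sub>1 \<subseteq> H" "H\<^sub>1 \<inter> K = H \<inter> K"
      "\<forall>h \<in> H\<^sub>1. real (word_length G S h) < syllable_bound \<mu> \<longrightarrow> h \<in> H \<inter> K"
    then interpret malnormal_pair G S \<delta> \<mu> H K H\<^sub>1
      using assms(7)
      by (intro malnormal_pair.intro malnormal_pair_axioms.intro hyperbolic_group_axioms) auto
    show "is_amalgam_of G H\<^sub>1 K (H \<inter> K) \<and>
       (quasiconvex G S H\<^sub>1 \<longrightarrow> quasiconvex G S (generate G (H\<^sub>1 \<union> K)))"
      using amalgam quasiconvex_M by blast
  qed
qed

end
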